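(* Let $\mu$ be a probability measure on $E$ and $\psi:E\to\mathbb{R}^n$ a diffeomorphism. If $\psi_*\mu=\gamma$ is the standard Gaussian measure on $\mathbb{R}^n$, then for all smooth $f:E\to\mathbb{R}$ with $f>0$, $$\mathrm{Ent}_\mu(f)\le\frac12\int\frac{\|\nabla_\psi f\|^2}{f}\,d\mu.$$ More generally, if $\psi_*\mu$ satisfies a log-Sobolev inequality with constant $\rho$, then $\mu$ satisfies the $\psi$-log-Sobolev inequality with the same constant, i.e. for all smooth $f>0$ on $E$, $$\mathrm{Ent}_\mu(f)\le\frac1{2\rho}\int\frac{\|\nabla_\psi f\|^2}{f}\,d\mu.$$
   Context: Here $E$ is a smooth $n$-dimensional space (for instance an open subset of $\mathbb{R}^n$) and $\psi$ is a smooth diffeomorphism onto $\mathbb{R}^n$. The pushforward is $(\psi_*\mu)(B)=\mu(\psi^{-1}(B))$. The entropy of a nonnegative function is $\mathrm{Ent}_\mu(f)=\int f\log f\,d\mu-\int f\,d\mu\cdot\log\int f\,d\mu$ (considered for $f$ for which it is defined). The $\psi$-gradient of $f:E\to\mathbb{R}$ at $x\in E$ is $\nabla_\psi f(x):=(\nabla(f\circ\psi^{-1}))(\psi(x))$, which equals $(D\psi(x))^{-T}\nabla f(x)$ when $E\subseteq\mathbb{R}^n$ is open. A probability measure $\nu$ on $\mathbb{R}^n$ satisfies a log-Sobolev inequality with constant $\rho>0$ if $\mathrm{Ent}_\nu(g)\le\frac{1}{2\rho}\int\frac{\|\nabla g\|^2}{g}\,d\nu$ for all smooth $g>0$. *)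

theory Defs
  imports "HOL-Probability.Probability"
begin

section \<open>Smooth maps between open subsets of normed spaces\<close>

text \<open>
  For an open set \<open>S\<close> in a finite-dimensional space, \<open>C_on k S f\<close> says that \<open>f\<close> is \<open>k\<close> times
  continuously differentiable on \<open>S\<close>: \<open>f\<close> is differentiable and all its directional derivatives are
  \<open>k - 1\<close> times continuously differentiable.
\<close>

fun C_on :: "nat \<Rightarrow> 'a::real_normed_vector set \<Rightarrow> ('a \<Rightarrow> 'b::real_normed_vector) \<Rightarrow> bool" where
  "C_on 0 S f \<longleftrightarrow> continuous_on S f"
| "C_on (Suc k) S f \<longleftrightarrow>
     (\<forall>x\<in>S. f differentiable (at x)) \<and> (\<forall>v. C_on k S (\<lambda>x. frechet_derivative f (at x) v))"

definition smooth_on :: "'a::real_normed_vector set \<Rightarrow> ('a \<Rightarrow> 'b::real_normed_vector) \<Rightarrow> bool" where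
  "smooth_on S f \<longleftrightarrow> (\<forall>k. C_on k S f)"

section \<open>Smooth manifolds, smooth maps and diffeomorphisms\<close>

text \<open>
  A manifold is a topological space \<open>X\<close> with an atlas, a set of charts \<open>(U, \<phi>)\<close>.  Only the values
  of \<open>\<phi>\<close> on \<open>U\<close> matter; \<open>inv_into U \<phi>\<close> is the inverse chart.
\<close>

type_synonym ('p, 'a) chart = "'p set \<times> ('p \<Rightarrow> 'a)"

definition is_chart :: "'p topology \<Rightarrow> ('p, 'a::euclidean_space) chart \<Rightarrow> bool" where
  "is_chart X = (\<lambda>(U, \<phi>). openin X U \<and> open (\<phi> ` U) \<and>
     homeomorphic_map (subtopology X U) (top_of_set (\<phi> ` U)) \<phi>)"

definition smooth_manifold :: "'p topology \<Rightarrow> ('p, 'a::euclidean_space) chart set \<Rightarrow> bool" where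
  "smooth_manifold X A \<longleftrightarrow>
     Hausdorff_space X \<and> second_countable X \<and>
     (\<forall>c\<in>A. is_chart X c) \<and> (\<Union>c\<in>A. fst c) = topspace X \<and>
     (\<forall>(U, \<phi>)\<in>A. \<forall>(V, \<eta>)\<in>A. smooth_on (\<phi> ` (U \<inter> V)) (\<eta> \<circ> inv_into U \<phi>))"

definition smooth_map ::
  "'p topology \<Rightarrow> ('p, 'a::euclidean_space) chart set \<Rightarrow>
   'q topology \<Rightarrow> ('q, 'b::euclidean_space) chart set \<Rightarrow> ('p \<Rightarrow> 'q) \<Rightarrow> bool" where
  "smooth_map X A Y B f \<longleftrightarrow>
     continuous_map X Y f \<and>
     (\<forall>(U, \<phi>)\<in>A. \<forall>(V, \<eta>)\<in>B. smooth_on (\<phi> ` (U \<inter> f -` V)) (\<eta> \<circ> f \<circ> inv_into U \<phi>))"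

definition diffeomorphism ::
  "'p topology \<Rightarrow> ('p, 'a::euclidean_space) chart set \<Rightarrow>
   'q topology \<Rightarrow> ('q, 'b::euclidean_space) chart set \<Rightarrow> ('p \<Rightarrow> 'q) \<Rightarrow> bool" where
  "diffeomorphism X A Y B f \<longleftrightarrow>
     bij_betw f (topspace X) (topspace Y) \<and>
     smooth_map X A Y B f \<and> smooth_map Y B X A (inv_into (topspace X) f)"

text \<open>The standard smooth structure of an open subset of a Euclidean space.\<close>

definition std_atlas :: "'a::euclidean_space set \<Rightarrow> ('a, 'a) chart set" where
  "std_atlas S = {(S, id)}"

abbreviation smooth_fun ::
  "'p topology \<Rightarrow> ('p, 'a::euclidean_space) chart set \<Rightarrow> ('p \<Rightarrow> real) \<Rightarrow> bool" where
  "smooth_fun X A \<equiv> smooth_map X A euclidean (std_atlas UNIV)"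

lemma frechet_derivative_eq_on_open:
  assumes "open S" "x \<in> S" "\<And>y. y \<in> S \<Longrightarrow> f y = g y"
  shows "frechet_derivative f (at x) = frechet_derivative g (at x)"
proof -
  have "(f has_derivative D) (at x) \<longleftrightarrow> (g has_derivative D) (at x)" for D
    by (metis assms has_derivative_transform_within_open)
  then show ?thesis
    by (simp add: frechet_derivative_def)
qed

lemma C_on_cong_open:
  assumes "open S" "\<And>y. y \<in> S \<Longrightarrow> f y = g y"
  shows "C_on k S f \<longleftrightarrow> C_on k S g"
  using assms(2)
proof (induction k arbitrary: f g)
  case 0
  then show ?case by (simp cong: continuous_on_cong)
next
  case (Suc k)
  have "f differentiable (at x) \<longleftrightarrow> g differentiable (at x)" if "x \<in> S" for x
    unfolding differentiable_def
    by (metis Suc.prems assms(1) has_derivative_transform_within_open that)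
  moreover have "C_on k S (\<lambda>x. frechet_derivative f (at x) v) \<longleftrightarrow>
                 C_on k S (\<lambda>x. frechet_derivative g (at x) v)" for v
    by (rule Suc.IH) (metis Suc.prems assms(1) frechet_derivative_eq_on_open)
  ultimately show ?case by simp
qed

lemma smooth_on_cong_open:
  assumes "open S" "\<And>y. y \<in> S \<Longrightarrow> f y = g y"
  shows "smooth_on S f \<longleftrightarrow> smooth_on S g"
  using C_on_cong_open[OF assms] by (simp add: smooth_on_def)

lemma C_on_const: "C_on k S (\<lambda>x. c)"
  by (induction k arbitrary: c) auto

lemma smooth_on_id: "smooth_on S id"
proof -
  have "C_on k S (\<lambda>x. x)" for k
    by (cases k) (auto simp: C_on_const)
  then show ?thesis by (simp add: smooth_on_def id_def)
qed

lemma smooth_on_imp_continuous_on: "smooth_on S f \<Longrightarrow> continuous_on S f"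
  by (metis C_on.simps(1) smooth_on_def)

lemma second_countable_euclidean:
  "second_countable (euclidean :: 'a::second_countable_topology topology)"
proof -
  obtain B :: "'a set set" where "countable B" "topological_basis B"
    using ex_countable_basis by blast
  then show ?thesis
    unfolding second_countable_def
    by (metis open_openin topological_basisE topological_basis_open)
qed

lemma smooth_manifold_open_subset:
  fixes S :: "'a::euclidean_space set"
  assumes "open S"
  shows "smooth_manifold (top_of_set S) (std_atlas S)"
proof -
  have "smooth_on S (id \<circ> inv_into S id)"
  proof (subst smooth_on_cong_open[OF assms, of _ id])
    show "(id \<circ> inv_into S id) y = id y" if "y \<in> S" for y
      by (metis comp_apply id_apply inv_into_f_f inj_on_id that)
  qed (rule smooth_on_id)
  moreover have "is_chart (top_of_set S) (S, id)"
    using assms by (simp add: is_chart_def subtopology_subtopology)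
  ultimately show ?thesis
    by (simp add: smooth_manifold_def std_atlas_def second_countable_subtopology
        second_countable_euclidean Hausdorff_space_subtopology)
qed

lemma smooth_map_open_subset:
  fixes f :: "'a::euclidean_space \<Rightarrow> 'b::euclidean_space"
  assumes "open S"
  shows "smooth_map (top_of_set S) (std_atlas S) euclidean (std_atlas UNIV) f \<longleftrightarrow> smooth_on S f"
proof -
  have "smooth_on S (f \<circ> inv_into S id) \<longleftrightarrow> smooth_on S f"
    by (rule smooth_on_cong_open[OF assms]) (metis comp_apply id_apply inv_into_f_f inj_on_id)
  then show ?thesis
    using smooth_on_imp_continuous_on by (auto simp: smooth_map_def std_atlas_def)
qed

section \<open>Measures\<close>

definition borel_of :: "'p topology \<Rightarrow> 'p measure" where
  "borel_of X = sigma (topspace X) {U. openin X U}"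

definition std_gaussian :: "(real ^ 'n) measure" where
  "std_gaussian = density lborel (\<lambda>x. ennreal (\<Prod>i\<in>UNIV. std_normal_density (x $ i)))"

lemma std_gaussian_density:
  fixes x :: "real ^ 'n"
  shows "(\<Prod>i\<in>UNIV. std_normal_density (x $ i)) =
    exp (- (norm x)\<^sup>2 / 2) / sqrt (2 * pi) ^ CARD('n)"
proof -
  have "(norm x)\<^sup>2 = (\<Sum>i\<in>UNIV. (x $ i)\<^sup>2)"
    by (simp add: norm_vec_def L2_set_def sum_nonneg)
  then have "(\<Prod>i\<in>UNIV. exp (- (x $ i)\<^sup>2 / 2)) = exp (- (norm x)\<^sup>2 / 2)"
    by (simp add: sum_negf flip: exp_sum sum_divide_distrib)
  then show ?thesis
    unfolding std_normal_density_def prod.distrib by (simp add: power_one_over)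
qed

section \<open>Entropy, gradients and log-Sobolev inequalities\<close>

text \<open>
  The integral of a function, as an extended real number, for functions whose negative part (or
  whose positive part) has finite integral.
\<close>

definition ext_integral :: "'p measure \<Rightarrow> ('p \<Rightarrow> real) \<Rightarrow> ereal" where
  "ext_integral M h =
     enn2ereal (\<integral>\<^sup>+ x. ennreal (h x) \<partial>M) - enn2ereal (\<integral>\<^sup>+ x. ennreal (- h x) \<partial>M)"

text \<open>
  On a probability space the negative part of \<open>f log f\<close> is bounded, so for nonnegative
  \<open>f\<close> the first term below is well defined, with values in \<open>(-\<infinity>, \<infinity>]\<close>.  Hence
  the entropy is defined (possibly as \<open>\<infinity>\<close>) exactly when \<open>f\<close> is integrable; this is required below
  wherever \<open>Ent\<close> is used.
\<close>

definition Ent :: "'p measure \<Rightarrow> ('p \<Rightarrow> real) \<Rightarrow> ereal" where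
  "Ent M f = ext_integral M (\<lambda>x. f x * ln (f x)) - ereal ((\<integral>x. f x \<partial>M) * ln (\<integral>x. f x \<partial>M))"

definition grad :: "('a::euclidean_space \<Rightarrow> real) \<Rightarrow> 'a \<Rightarrow> 'a" where
  "grad g y = (THE D. GDERIV g y :> D)"

definition psi_grad ::
  "'p topology \<Rightarrow> ('p \<Rightarrow> 'a::euclidean_space) \<Rightarrow> ('p \<Rightarrow> real) \<Rightarrow> 'p \<Rightarrow> 'a" where
  "psi_grad X \<psi> f x = grad (f \<circ> inv_into (topspace X) \<psi>) (\<psi> x)"

definition log_sobolev :: "'a::euclidean_space measure \<Rightarrow> real \<Rightarrow> bool" where
  "log_sobolev \<nu> \<rho> \<longleftrightarrow>
     (\<forall>g. smooth_on UNIV g \<and> (\<forall>y. 0 < g y) \<and> integrable \<nu> g \<longrightarrow>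
       Ent \<nu> g \<le> ereal (1 / (2 * \<rho>)) *
         enn2ereal (\<integral>\<^sup>+ y. ennreal ((norm (grad g y))\<^sup>2 / g y) \<partial>\<nu>))"

end

theory Submission
  imports Defs
begin

text \<open>
  The general statement is a change of variables: \<open>g = f \<circ> \<psi>\<inverse>\<close> is smooth, has the entropy of \<open>f\<close>,
  and its gradient at \<open>\<psi> x\<close> is the \<open>\<psi>\<close>-gradient of \<open>f\<close> at \<open>x\<close>.

  What remains is Gross's inequality for the standard Gaussian measure.  Write it as the \<open>N\<close>-fold
  convolution of the centred Gaussian of variance \<open>h = 1 / N\<close>.  For one such step, a second order
  expansion of \<open>x ln x\<close> gives \<open>Ent f \<le> h / 2 * \<integral> |\<nabla>f|\<^sup>2 / f + O(h powr (3/2))\<close>.  By the chain rule of entropy and the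
  joint convexity of \<open>|v|\<^sup>2 / u\<close>, such inequalities add up under convolution, so that the total error
  is \<open>O(N powr (-1/2))\<close>.  This treats bounded \<open>f \<ge> c > 0\<close> with bounded Lipschitz gradient; truncation and Fatou's
  lemma give the general case.
\<close>

section \<open>Second order expansions\<close>

text \<open>The sharp factor 1/2 is the Taylor coefficient \<open>1 / (2 * a)\<close> of x ln x at
  a, multiplied by the variance \<open>h * (norm v)\<^sup>2\<close> of a linear form v under a
  Gaussian of variance h. The error order h powr (3/2) is that of the third absolute moment. The
  obstacle is uniformity: the function changes after every convolution, yet one error constant must
  serve all N steps. Hence the test functions form a class cut out by bounds c, B, L, K that
  translation and averaging preserve, and each step is stated for the whole class. The gradient is
  carried along as a second function G, averaged together with f, so that nothing is ever
  differentiated under an integral.\<close>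

lemma ln_le_half_diff_inverse:
  fixes u :: real
  assumes "1 \<le> u"
  shows "ln u \<le> (u - 1 / u) / 2"
proof -
  have "(\<lambda>u. (u - 1 / u) / 2 - ln u) 1 \<le> (\<lambda>u. (u - 1 / u) / 2 - ln u) u"
  proof (rule DERIV_nonneg_imp_nondecreasing[OF assms])
    fix x :: real assume x: "1 \<le> x" "x \<le> u"
    have "((\<lambda>u. (u - 1 / u) / 2 - ln u) has_real_derivative (1 - 1 / x)\<^sup>2 / 2) (at x)"
      using x by (auto intro!: derivative_eq_intros simp: field_simps power2_eq_square)
    then show "\<exists>y. ((\<lambda>u. (u - 1 / u) / 2 - ln u) has_real_derivative y) (at x) \<and> 0 \<le> y"
      by (intro exI[of _ "(1 - 1 / x)\<^sup>2 / 2"]) auto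
  qed
  then show ?thesis by simp
qed

lemma ln_one_minus_le:
  fixes t :: real
  assumes "0 \<le> t" "t < 1"
  shows "ln (1 - t) \<le> - t - t\<^sup>2 / 2"
proof -
  have "(\<lambda>t. - t - t\<^sup>2 / 2 - ln (1 - t)) 0 \<le> (\<lambda>t. - t - t\<^sup>2 / 2 - ln (1 - t)) t"
  proof (rule DERIV_nonneg_imp_nondecreasing[OF assms(1)])
    fix x :: real assume x: "0 \<le> x" "x \<le> t"
    have "((\<lambda>t. - t - t\<^sup>2 / 2 - ln (1 - t)) has_real_derivative x\<^sup>2 / (1 - x)) (at x)"
      using x assms by (auto intro!: derivative_eq_intros simp: field_simps power2_eq_square)
    then show "\<exists>y. ((\<lambda>t. - t - t\<^sup>2 / 2 - ln (1 - t)) has_real_derivative y) (at x) \<and> 0 \<le> y"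
      using x assms by (intro exI[of _ "x\<^sup>2 / (1 - x)"]) auto
  qed
  then show ?thesis by simp
qed

text \<open>Above 1 the second order Taylor polynomial already dominates, since u times the bound on
  ln u equals it exactly. Below 1, with t = 1 - u, multiplying the bound on ln (1 - t) by 1 - t
  leaves the remainder t^3 / 2; this is the source of the factor 1/2. The estimate holds for every u
  > 0, not only near 1, so it can be integrated against a measure with unbounded support.\<close>

lemma x_ln_x_le_expansion_at_1:
  fixes u :: real
  assumes "0 < u"
  shows "u * ln u \<le> (u - 1) + (u - 1)\<^sup>2 / 2 + \<bar>u - 1\<bar> ^ 3 / 2"
proof (cases "1 \<le> u")
  case True
  have "u * ln u \<le> u * ((u - 1 / u) / 2)"
    using True ln_le_half_diff_inverse by (intro mult_left_mono) auto
  also have "\<dots> = (u - 1) + (u - 1)\<^sup>2 / 2"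
    using True by (simp add: field_simps power2_eq_square)
  also have "\<dots> \<le> (u - 1) + (u - 1)\<^sup>2 / 2 + \<bar>u - 1\<bar> ^ 3 / 2"
    by simp
  finally show ?thesis .
next
  case False
  have "u * ln u \<le> u * (- (1 - u) - (1 - u)\<^sup>2 / 2)"
    using False assms ln_one_minus_le[of "1 - u"] by (intro mult_left_mono) auto
  also have "\<dots> = (u - 1) + (u - 1)\<^sup>2 / 2 + \<bar>u - 1\<bar> ^ 3 / 2"
    using False by (simp add: field_simps power2_eq_square power3_eq_cube)
  finally show ?thesis .
qed

text \<open>Homogeneity: the case a = 1 is applied to \<open>x / a\<close> and multiplied by
  a.\<close>

lemma x_ln_x_le_expansion:
  fixes a x :: real
  assumes "0 < a" "0 < x"
  shows "x * ln x \<le> a * ln a + (ln a + 1) * (x - a) + (x - a)\<^sup>2 / (2 * a) + \<bar>x - a\<bar> ^ 3 / (2 * a\<^sup>2)"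
proof -
  have "a * (x / a * ln (x / a))
      \<le> a * ((x / a - 1) + (x / a - 1)\<^sup>2 / 2 + \<bar>x / a - 1\<bar> ^ 3 / 2)"
    using assms by (intro mult_left_mono x_ln_x_le_expansion_at_1) auto
  moreover have "x / a - 1 = (x - a) / a"
    using assms by (simp add: field_simps)
  moreover have "a * (x / a * ln (x / a)) = x * ln x - x * ln a"
    using assms by (simp add: ln_div algebra_simps)
  moreover have "a * ((x - a) / a + ((x - a) / a)\<^sup>2 / 2 + \<bar>(x - a) / a\<bar> ^ 3 / 2)
      = (x - a) + (x - a)\<^sup>2 / (2 * a) + \<bar>x - a\<bar> ^ 3 / (2 * a\<^sup>2)"
    using assms by (simp add: field_simps power2_eq_square power3_eq_cube abs_divide)
  ultimately have "x * ln x - x * ln a \<le> (x - a) + (x - a)\<^sup>2 / (2 * a) + \<bar>x - a\<bar> ^ 3 / (2 * a\<^sup>2)"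
    by metis
  then show ?thesis
    by (simp add: algebra_simps)
qed

lemma x_ln_x_ge_tangent:
  fixes a x :: real
  assumes "0 < a" "0 < x"
  shows "a * ln a + (ln a + 1) * (x - a) \<le> x * ln x"
proof -
  have "x * ln (a / x) \<le> x * (a / x - 1)"
    using assms ln_le_minus_one by (intro mult_left_mono) auto
  then show ?thesis
    using assms by (simp add: ln_div algebra_simps)
qed

section \<open>Test functions with uniform bounds\<close>

lemma integrable_bounded_real:
  fixes g :: "'a \<Rightarrow> 'b::{banach, second_countable_topology}"
  assumes "prob_space M" "g \<in> borel_measurable M" "\<And>x. norm (g x) \<le> b"
  shows "integrable M g"
  by (rule finite_measure.integrable_const_bound[where B = b])
    (use assms prob_space.finite_measure[of M] in auto)

text \<open>G stands for the gradient of f, but is tied to it only by the quadratic Taylor estimate.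
  All conditions are convex in the pair (f, G) and uniform in the base point, which is what makes
  the class stable under averages of translates.\<close>

locale tame =
  fixes c B L K :: real and f :: "'a::euclidean_space \<Rightarrow> real" and G :: "'a \<Rightarrow> 'a"
  assumes c_pos: "0 < c" and K_nonneg: "0 \<le> K"
    and lower: "\<And>x. c \<le> f x" and upper: "\<And>x. f x \<le> B"
    and norm_G: "\<And>x. norm (G x) \<le> L"
    and lipschitz_G: "\<And>x w. norm (G (x + w) - G x) \<le> K * norm w"
    and lipschitz_f: "\<And>x w. \<bar>f (x + w) - f x\<bar> \<le> L * norm w"
    and taylor: "\<And>x w. \<bar>f (x + w) - f x - G x \<bullet> w\<bar> \<le> K * (norm w)\<^sup>2"
begin

lemma pos: "0 < f x"
  using c_pos lower[of x] by simp

lemma L_nonneg: "0 \<le> L"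
  by (rule order_trans[OF norm_ge_zero norm_G])

lemma B_pos: "0 < B"
  by (rule less_le_trans[OF pos upper])

lemma measurable_f [measurable]: "f \<in> borel_measurable borel"
proof -
  have "L-lipschitz_on UNIV f"
    using lipschitz_f[of y "x - y" for x y] L_nonneg
    by (intro lipschitz_onI) (auto simp: dist_norm)
  then show ?thesis
    by (intro borel_measurable_continuous_onI lipschitz_on_continuous_on)
qed

lemma measurable_G [measurable]: "G \<in> borel_measurable borel"
proof -
  have "K-lipschitz_on UNIV G"
    using lipschitz_G[of y "x - y" for x y] K_nonneg
    by (intro lipschitz_onI) (auto simp: dist_norm)
  then show ?thesis
    by (intro borel_measurable_continuous_onI lipschitz_on_continuous_on)
qed

lemma f_ln_f_bound: "norm (f x * ln (f x)) \<le> B * (\<bar>ln c\<bar> + \<bar>ln B\<bar>)"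
proof -
  have "ln c \<le> ln (f x)" "ln (f x) \<le> ln B"
    using c_pos lower upper pos B_pos by auto
  then have "\<bar>ln (f x)\<bar> \<le> \<bar>ln c\<bar> + \<bar>ln B\<bar>" by linarith
  then show ?thesis
    unfolding real_norm_def abs_mult
    using pos[of x] upper[of x] B_pos by (intro mult_mono) auto
qed

lemma fisher_bound: "norm ((norm (G x))\<^sup>2 / f x) \<le> L\<^sup>2 / c"
  using norm_G[of x] lower[of x] c_pos pos[of x]
  by (simp add: frac_le power_mono)

text \<open>The difference of quotients is split at \<open>a\<^sup>2 / q\<close>. Changing the
  numerator costs 2 L K / c, changing the denominator costs L^3 / c^2. The estimate later trades the
  Fisher integrand at one point for its mean.\<close>

lemma lipschitz_fisher:
  "(norm (G y))\<^sup>2 / f y \<le> (norm (G (y + w)))\<^sup>2 / f (y + w) + (2 * L * K / c + L ^ 3 / c\<^sup>2) * norm w"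
proof -
  define a b where "a = norm (G y)" and "b = norm (G (y + w))"
  define p q where "p = f y" and "q = f (y + w)"
  have ab: "\<bar>a - b\<bar> \<le> K * norm w" "0 \<le> a" "0 \<le> b" "a \<le> L" "b \<le> L"
    using lipschitz_G[of y w] norm_triangle_ineq3[of "G (y + w)" "G y"] norm_G
    by (auto simp: a_def b_def)
  have pq: "\<bar>q - p\<bar> \<le> L * norm w" "c \<le> p" "c \<le> q" "0 < p" "0 < q"
    using lipschitz_f lower pos by (auto simp: p_def q_def)
  have "(a\<^sup>2 - b\<^sup>2) / q \<le> 2 * L * K * norm w / c"
  proof -
    have "a\<^sup>2 - b\<^sup>2 = (a - b) * (a + b)" by (simp add: power2_eq_square algebra_simps)
    also have "\<dots> \<le> (K * norm w) * (2 * L)"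
      using ab K_nonneg by (intro mult_mono) auto
    finally show ?thesis
      using pq c_pos L_nonneg K_nonneg by (intro frac_le) (auto simp: mult_ac)
  qed
  moreover have "a\<^sup>2 / p - a\<^sup>2 / q \<le> L ^ 3 / c\<^sup>2 * norm w"
  proof -
    have "a\<^sup>2 / p - a\<^sup>2 / q = a\<^sup>2 * (q - p) / (p * q)"
      using pq by (simp add: field_simps)
    also have "\<dots> \<le> a\<^sup>2 * \<bar>q - p\<bar> / (p * q)"
      using pq by (intro divide_right_mono mult_left_mono) auto
    also have "\<dots> \<le> L\<^sup>2 * (L * norm w) / (c * c)"
      using ab pq c_pos L_nonneg
      by (intro frac_le mult_mono[of "a\<^sup>2"] mult_mono[of c] power_mono mult_nonneg_nonneg) auto
    finally show ?thesis
      by (simp add: power2_eq_square power3_eq_cube mult_ac)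
  qed
  ultimately show ?thesis
    unfolding a_def[symmetric] b_def[symmetric] p_def[symmetric] q_def[symmetric]
    by (simp add: distrib_right diff_divide_distrib)
qed

end

section \<open>Small steps and convolution\<close>

lemma norm_mean_le:
  fixes g :: "'a \<Rightarrow> 'b::{banach, second_countable_topology}"
  assumes "prob_space M" "\<And>x. norm (g x) \<le> b"
  shows "norm (\<integral>x. g x \<partial>M) \<le> b"
proof (cases "integrable M g")
  case True
  interpret prob_space M by fact
  have "norm (\<integral>x. g x \<partial>M) \<le> (\<integral>x. norm (g x) \<partial>M)"
    by simp
  also have "\<dots> \<le> (\<integral>x. b \<partial>M)"
    using True assms by (intro integral_mono) auto
  finally show ?thesis by (simp add: prob_space)
next
  \<comment> \<open>The Bochner integral of a non-integrable function is 0, and b is nonnegative, so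
    the bound persists.\<close>
  case False
  then show ?thesis
    using order_trans[OF norm_ge_zero assms(2)] by (simp add: not_integrable_integral_eq)
qed

lemma (in tame) tame_shift: "tame c B L K (\<lambda>x. f (y + x)) (\<lambda>x. G (y + x))"
  by unfold_locales
    (use c_pos K_nonneg lower upper norm_G lipschitz_G lipschitz_f taylor in \<open>auto simp flip: add.assoc\<close>)

locale tame_prob = tame c B L K f G + prob_space M
  for c B L K and f :: "'a::euclidean_space \<Rightarrow> real" and G and M :: "'a measure" +
  assumes sets_M [measurable_cong]: "sets M = sets borel"
begin

lemma integrable_shifts:
  shows "integrable M (\<lambda>w. f (y + w))"
    and "integrable M (\<lambda>w. G (y + w))"
    and "integrable M (\<lambda>w. f (y + w) * ln (f (y + w)))"
    and "integrable M (\<lambda>w. (norm (G (y + w)))\<^sup>2 / f (y + w))"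
proof -
  note bounded = integrable_bounded_real[OF prob_space_axioms]
  have f_bound: "norm (f x) \<le> B" for x
    using upper[of x] pos[of x] by simp
  show "integrable M (\<lambda>w. f (y + w))"
    by (rule bounded[OF _ f_bound]) measurable
  show "integrable M (\<lambda>w. G (y + w))"
    by (rule bounded[OF _ norm_G]) measurable
  show "integrable M (\<lambda>w. f (y + w) * ln (f (y + w)))"
    by (rule bounded[OF _ f_ln_f_bound]) measurable
  show "integrable M (\<lambda>w. (norm (G (y + w)))\<^sup>2 / f (y + w))"
    by (rule bounded[OF _ fisher_bound]) measurable
qed

text \<open>Every condition is an estimate at x, or between x and x + w, with constants independent
  of x. Averaging over translates therefore keeps c, B, L and K unchanged, and iterated averages do
  not degrade.\<close>

lemma tame_mean: "tame c B L K (\<lambda>y. \<integral>w. f (y + w) \<partial>M) (\<lambda>y. \<integral>w. G (y + w) \<partial>M)"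
proof
  note int = integrable_shifts(1,2)
  show "0 < c" "0 \<le> K" by (fact c_pos, fact K_nonneg)
  fix x w
  show "c \<le> (\<integral>u. f (x + u) \<partial>M)"
    using integral_mono[of M "\<lambda>_. c" "\<lambda>u. f (x + u)"] int lower by (simp add: prob_space)
  show "(\<integral>u. f (x + u) \<partial>M) \<le> B"
    using integral_mono[of M "\<lambda>u. f (x + u)" "\<lambda>_. B"] int upper by (simp add: prob_space)
  show "norm (\<integral>u. G (x + u) \<partial>M) \<le> L"
    by (intro norm_mean_le prob_space_axioms norm_G)
  have "norm (\<integral>u. G (x + w + u) - G (x + u) \<partial>M) \<le> K * norm w"
    using lipschitz_G[of "x + u" w for u]
    by (intro norm_mean_le prob_space_axioms) (simp add: add_ac)
  then show "norm ((\<integral>u. G (x + w + u) \<partial>M) - (\<integral>u. G (x + u) \<partial>M)) \<le> K * norm w"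
    by (simp add: int)
  have "norm (\<integral>u. f (x + w + u) - f (x + u) \<partial>M) \<le> L * norm w"
    using lipschitz_f[of "x + u" w for u]
    by (intro norm_mean_le prob_space_axioms) (simp add: add_ac)
  then show "\<bar>(\<integral>u. f (x + w + u) \<partial>M) - (\<integral>u. f (x + u) \<partial>M)\<bar> \<le> L * norm w"
    by (simp add: int)
  have "norm (\<integral>u. f (x + w + u) - f (x + u) - G (x + u) \<bullet> w \<partial>M) \<le> K * (norm w)\<^sup>2"
    using taylor[of "x + u" w for u]
    by (intro norm_mean_le prob_space_axioms) (simp add: add_ac)
  moreover have "(\<integral>u. f (x + w + u) - f (x + u) - G (x + u) \<bullet> w \<partial>M)
      = (\<integral>u. f (x + w + u) \<partial>M) - (\<integral>u. f (x + u) \<partial>M) - (\<integral>u. G (x + u) \<partial>M) \<bullet> w"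
    using int by (subst Bochner_Integration.integral_diff | subst integral_inner_left)+ auto
  ultimately show "\<bar>(\<integral>u. f (x + w + u) \<partial>M) - (\<integral>u. f (x + u) \<partial>M) - (\<integral>u. G (x + u) \<partial>M) \<bullet> w\<bar>
      \<le> K * (norm w)\<^sup>2"
    by simp
qed

text \<open>The perspective \<open>(g, u) \<mapsto> |g|\<^sup>2 / u\<close> is convex; the proof bounds it from below by its tangent
  at the mean.\<close>

lemma fisher_mean_le:
  "(norm (\<integral>w. G (y + w) \<partial>M))\<^sup>2 / (\<integral>w. f (y + w) \<partial>M) \<le> (\<integral>w. (norm (G (y + w)))\<^sup>2 / f (y + w) \<partial>M)"
proof -
  define m g v where "m = (\<integral>w. f (y + w) \<partial>M)" and "g = (\<integral>w. G (y + w) \<partial>M)" and "v = g /\<^sub>R m"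
  note int = integrable_shifts(1,2,4)
  have m: "0 < m"
    using tame.pos[OF tame_mean] by (simp add: m_def)
  have ptw: "2 * (G x \<bullet> v) - (norm v)\<^sup>2 * f x \<le> (norm (G x))\<^sup>2 / f x" for x
  proof -
    have "0 \<le> (norm (G x - f x *\<^sub>R v))\<^sup>2 / f x"
      using pos[of x] by simp
    also have "(norm (G x - f x *\<^sub>R v))\<^sup>2 = (norm (G x))\<^sup>2 - 2 * f x * (G x \<bullet> v) + (f x)\<^sup>2 * (norm v)\<^sup>2"
      unfolding power2_norm_eq_inner
      by (simp add: inner_diff inner_commute algebra_simps power2_eq_square)
    finally show ?thesis
      using pos[of x] by (simp add: field_simps power2_eq_square)
  qed
  have "(\<integral>w. 2 * (G (y + w) \<bullet> v) - (norm v)\<^sup>2 * f (y + w) \<partial>M)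
      \<le> (\<integral>w. (norm (G (y + w)))\<^sup>2 / f (y + w) \<partial>M)"
    using int ptw by (intro integral_mono) auto
  moreover have "(\<integral>w. 2 * (G (y + w) \<bullet> v) - (norm v)\<^sup>2 * f (y + w) \<partial>M) = 2 * (g \<bullet> v) - (norm v)\<^sup>2 * m"
    using int by (simp add: g_def m_def)
  moreover have "2 * (g \<bullet> v) - (norm v)\<^sup>2 * m = (norm g)\<^sup>2 / m"
    using m unfolding power2_norm_eq_inner by (simp add: v_def field_simps)
  ultimately show ?thesis
    by (simp add: g_def m_def)
qed

text \<open>Everything is expanded around the value at 0. The first order term is kept as
  \<open>f w - a\<close> instead of being expanded in w, so its mean is \<open>m - a\<close>, which
  convexity of x ln x absorbs. The second order term produces h / 2 times the Fisher integrand at 0,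
  which is finally compared with its mean. The bound e is spent twice, once on third order errors
  and once on that comparison.\<close>

lemma small_step:
  assumes h: "0 \<le> h"
    and second: "\<And>v. has_bochner_integral M (\<lambda>w. (v \<bullet> w)\<^sup>2) (h * (norm v)\<^sup>2)"
    and third: "integrable M (\<lambda>w. norm w ^ 3)" "(\<integral>w. norm w ^ 3 \<partial>M) \<le> e"
    and first: "integrable M norm" "h * (\<integral>w. norm w \<partial>M) \<le> e"
  shows "(\<integral>w. f w * ln (f w) \<partial>M) - (\<integral>w. f w \<partial>M) * ln (\<integral>w. f w \<partial>M)
      \<le> h / 2 * (\<integral>w. (norm (G w))\<^sup>2 / f w \<partial>M) + (2 * L * K / c + L ^ 3 / c\<^sup>2) * e"
proof -
  \<comment> \<open>C is half the Lipschitz constant of the Fisher integrand in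
    \<open>lipschitz_fisher\<close>; the two uses of \<open>C * e\<close> add up to the error
    claimed.\<close>
  define a m C where "a = f 0" and "m = (\<integral>w. f w \<partial>M)" and "C = K * L / c + L ^ 3 / (2 * c\<^sup>2)"
  define J where "J w = (norm (G w))\<^sup>2 / f w" for w
  note int = integrable_shifts[of 0, simplified]
  have a: "0 < a" "c \<le> a"
    using pos lower by (auto simp: a_def)
  have m: "0 < m"
    using tame.pos[OF tame_mean, of 0] by (simp add: m_def)
  have C: "0 \<le> C"
    using c_pos K_nonneg L_nonneg by (simp add: C_def)
  have ptw: "f w * ln (f w) \<le> a * ln a + (ln a + 1) * (f w - a) + (G 0 \<bullet> w)\<^sup>2 / (2 * a) + C * norm w ^ 3" for w
  proof -
    define X p where "X = f w - a" and "p = G 0 \<bullet> w"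
    have r: "\<bar>X - p\<bar> \<le> K * (norm w)\<^sup>2" and X: "\<bar>X\<bar> \<le> L * norm w"
      using taylor[of 0 w] lipschitz_f[of 0 w] by (simp_all add: X_def p_def a_def)
    have p: "\<bar>p\<bar> \<le> L * norm w"
      using Cauchy_Schwarz_ineq2[of "G 0" w] norm_G[of 0] mult_right_mono[OF norm_G[of 0] norm_ge_zero[of w]]
      by (simp add: p_def)
    \<comment> \<open>The factor X - p is of second order in w and X + p of first order, so the
      increment can be replaced by its linear part at third order cost.\<close>
    have "X\<^sup>2 - p\<^sup>2 = (X - p) * (X + p)"
      by (simp add: power2_eq_square algebra_simps)
    also have "\<dots> \<le> \<bar>X - p\<bar> * \<bar>X + p\<bar>"
      by (simp flip: abs_mult)
    also have "\<dots> \<le> (K * (norm w)\<^sup>2) * (2 * L * norm w)"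
      using r X p K_nonneg by (intro mult_mono) auto
    finally have "(X\<^sup>2 - p\<^sup>2) / (2 * a) \<le> (2 * K * L * norm w ^ 3) / (2 * c)"
      using a c_pos K_nonneg L_nonneg
      by (intro frac_le) (auto simp: power2_eq_square power3_eq_cube mult_ac)
    moreover have "\<bar>X\<bar> ^ 3 / (2 * a\<^sup>2) \<le> (L * norm w) ^ 3 / (2 * c\<^sup>2)"
      using X a c_pos L_nonneg by (intro frac_le power_mono mult_left_mono) auto
    moreover have "f w * ln (f w) \<le> a * ln a + (ln a + 1) * X + X\<^sup>2 / (2 * a) + \<bar>X\<bar> ^ 3 / (2 * a\<^sup>2)"
      unfolding X_def by (intro x_ln_x_le_expansion a pos)
    moreover have "C * norm w ^ 3 = (2 * K * L * norm w ^ 3) / (2 * c) + (L * norm w) ^ 3 / (2 * c\<^sup>2)"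
      by (simp add: C_def distrib_right power_mult_distrib)
    ultimately show ?thesis
      unfolding X_def[symmetric] p_def[symmetric] by (simp add: diff_divide_distrib)
  qed
  have "(\<integral>w. f w * ln (f w) \<partial>M)
      \<le> (\<integral>w. a * ln a + (ln a + 1) * (f w - a) + (G 0 \<bullet> w)\<^sup>2 / (2 * a) + C * norm w ^ 3 \<partial>M)"
    using int third second[of "G 0"] ptw by (intro integral_mono) (auto dest: integrable.intros)
  also have "\<dots> = a * ln a + (ln a + 1) * (m - a) + h * (norm (G 0))\<^sup>2 / (2 * a) + C * (\<integral>w. norm w ^ 3 \<partial>M)"
    using int third second[of "G 0"] integrable.intros[OF second[of "G 0"]]
    by (simp add: prob_space m_def has_bochner_integral_integral_eq)
  \<comment> \<open>The affine terms are the tangent of x ln x at a, evaluated at m, hence at most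
    \<open>m * ln m\<close>.\<close>
  also have "\<dots> \<le> m * ln m + h / 2 * J 0 + C * e"
    using x_ln_x_ge_tangent[OF a(1) m] mult_left_mono[OF third(2) C]
    by (simp add: J_def a_def)
  finally have "(\<integral>w. f w * ln (f w) \<partial>M) - m * ln m \<le> h / 2 * J 0 + C * e" by simp
  moreover have "h / 2 * J 0 \<le> h / 2 * (\<integral>w. J w \<partial>M) + C * e"
  proof -
    have "(\<integral>w. J 0 \<partial>M) \<le> (\<integral>w. J w + 2 * C * norm w \<partial>M)"
      using int first lipschitz_fisher[of 0]
      by (intro integral_mono) (auto simp: J_def C_def algebra_simps)
    then have "J 0 \<le> (\<integral>w. J w \<partial>M) + 2 * C * (\<integral>w. norm w \<partial>M)"
      using int first by (simp add: prob_space J_def)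
    then have "h / 2 * J 0 \<le> h / 2 * ((\<integral>w. J w \<partial>M) + 2 * C * (\<integral>w. norm w \<partial>M))"
      using h by (intro mult_left_mono) auto
    also have "\<dots> = h / 2 * (\<integral>w. J w \<partial>M) + C * (h * (\<integral>w. norm w \<partial>M))"
      by (simp add: algebra_simps)
    also have "\<dots> \<le> h / 2 * (\<integral>w. J w \<partial>M) + C * e"
      using mult_left_mono[OF first(2) C] by simp
    finally show ?thesis .
  qed
  ultimately show ?thesis
    by (simp add: J_def m_def C_def algebra_simps)
qed

end

text \<open>A log-Sobolev inequality with additive error e, in which t has the role of a variance.
  Quantifying over all tame pairs with fixed constants lets it be applied to translates and averages
  of the original function.\<close>

definition approx_lsi :: "real \<Rightarrow> real \<Rightarrow> real \<Rightarrow> real \<Rightarrow> 'a::euclidean_space measure \<Rightarrow> real \<Rightarrow> real \<Rightarrow> bool" where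
  "approx_lsi c B L K M t e \<longleftrightarrow> (\<forall>f G. tame c B L K f G \<longrightarrow>
     (\<integral>w. f w * ln (f w) \<partial>M) - (\<integral>w. f w \<partial>M) * ln (\<integral>w. f w \<partial>M)
       \<le> t / 2 * (\<integral>w. (norm (G w))\<^sup>2 / f w \<partial>M) + e)"

lemma integral_convolution_bounded:
  fixes g :: "'a::euclidean_space \<Rightarrow> real"
  assumes "prob_space M" "prob_space N"
    and [measurable_cong]: "sets M = sets borel" "sets N = sets borel"
    and [measurable]: "g \<in> borel_measurable borel" and "\<And>x. norm (g x) \<le> b"
  shows "(\<integral>x. g x \<partial>distr (N \<Otimes>\<^sub>M M) borel (\<lambda>(y, x). y + x)) = (\<integral>y. \<integral>x. g (y + x) \<partial>M \<partial>N)"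
    and "integrable N (\<lambda>y. \<integral>x. g (y + x) \<partial>M)"
proof -
  interpret M: prob_space M by fact
  interpret N: prob_space N by fact
  interpret pair_prob_space N M ..
  have int: "integrable (N \<Otimes>\<^sub>M M) (\<lambda>z. g (fst z + snd z))"
    by (rule integrable_bounded_real[where b = b]) (simp_all add: assms(6)[unfolded real_norm_def] prob_space_axioms)
  have "(\<integral>x. g x \<partial>distr (N \<Otimes>\<^sub>M M) borel (\<lambda>(y, x). y + x)) = (\<integral>z. g (fst z + snd z) \<partial>(N \<Otimes>\<^sub>M M))"
    by (subst integral_distr) (auto simp: case_prod_beta)
  then show "(\<integral>x. g x \<partial>distr (N \<Otimes>\<^sub>M M) borel (\<lambda>(y, x). y + x)) = (\<integral>y. \<integral>x. g (y + x) \<partial>M \<partial>N)"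
    using integral_fst'[OF int] by simp
  show "integrable N (\<lambda>y. \<integral>x. g (y + x) \<partial>M)"
    using integrable_fst'[OF int] by simp
qed

text \<open>The entropy under the convolution is the N-mean of the M-entropies of the translates
  \<open>f (y + x)\<close> plus the N-entropy of their M-mean \<open>Qf\<close>. The hypothesis on M
  bounds the first part, the one on N the second; both t and the error therefore add.\<close>

lemma approx_lsi_convolution:
  fixes M N :: "'a::euclidean_space measure"
  assumes M: "prob_space M" "sets M = sets borel" and N: "prob_space N" "sets N = sets borel"
    and lsi_M: "approx_lsi c B L K M s d" and lsi_N: "approx_lsi c B L K N t e"
    and "0 \<le> t"
  shows "approx_lsi c B L K (distr (N \<Otimes>\<^sub>M M) borel (\<lambda>(y, x). y + x)) (s + t) (d + e)"
  unfolding approx_lsi_def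
proof (intro allI impI)
  fix f and G :: "'a \<Rightarrow> 'a" assume "tame c B L K f G"
  interpret prob_space N by fact
  interpret tame c B L K f G by fact
  interpret MM: tame_prob c B L K f G M
    using M by (simp add: tame_prob_def tame_axioms tame_prob_axioms_def)
  let ?P = "distr (N \<Otimes>\<^sub>M M) borel (\<lambda>(y, x). y + x)"
  define Qf QG where "Qf y = (\<integral>x. f (y + x) \<partial>M)" and "QG y = (\<integral>x. G (y + x) \<partial>M)" for y
  interpret Q: tame c B L K Qf QG
    using MM.tame_mean by (simp add: Qf_def[abs_def] QG_def[abs_def])
  interpret NN: tame_prob c B L K Qf QG N
    using N by (simp add: tame_prob_def Q.tame_axioms tame_prob_axioms_def)
  let ?E = "\<lambda>y. \<integral>x. f (y + x) * ln (f (y + x)) \<partial>M" and ?J = "\<lambda>y. \<integral>x. (norm (G (y + x)))\<^sup>2 / f (y + x) \<partial>M"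
  note conv = integral_convolution_bounded[OF M(1) N(1) M(2) N(2)]
  have fB: "norm (f x) \<le> B" for x
    using upper[of x] pos[of x] by simp
  note f = conv[OF measurable_f fB]
  have E: "(\<integral>x. f x * ln (f x) \<partial>?P) = (\<integral>y. ?E y \<partial>N)" "integrable N ?E"
    by (rule conv[OF _ f_ln_f_bound], measurable)+
  have J: "(\<integral>x. (norm (G x))\<^sup>2 / f x \<partial>?P) = (\<integral>y. ?J y \<partial>N)" "integrable N ?J"
    by (rule conv[OF _ fisher_bound], measurable)+
  note int = NN.integrable_shifts[of 0, simplified]
  have step: "?E y \<le> Qf y * ln (Qf y) + s / 2 * ?J y + d" for y
    using lsi_M[unfolded approx_lsi_def, rule_format, OF tame_shift[of y]] by (simp add: Qf_def)
  have "(\<integral>y. ?E y \<partial>N) \<le> (\<integral>y. Qf y * ln (Qf y) + s / 2 * ?J y + d \<partial>N)"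
    using int E J step by (intro integral_mono) auto
  also have "\<dots> = (\<integral>y. Qf y * ln (Qf y) \<partial>N) + s / 2 * (\<integral>y. ?J y \<partial>N) + d"
    using int J by (simp add: prob_space)
  also have "(\<integral>y. Qf y * ln (Qf y) \<partial>N)
      \<le> (\<integral>y. Qf y \<partial>N) * ln (\<integral>y. Qf y \<partial>N) + t / 2 * (\<integral>y. (norm (QG y))\<^sup>2 / Qf y \<partial>N) + e"
    using lsi_N[unfolded approx_lsi_def, rule_format, OF Q.tame_axioms] by simp
  \<comment> \<open>Averaging over M does not increase the Fisher integrand, so both contributions
    are now multiples of the same integral.\<close>
  also have "(\<integral>y. (norm (QG y))\<^sup>2 / Qf y \<partial>N) \<le> (\<integral>y. ?J y \<partial>N)"
    using int J MM.fisher_mean_le by (intro integral_mono) (auto simp: Qf_def QG_def)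
  finally show "(\<integral>x. f x * ln (f x) \<partial>?P) - (\<integral>x. f x \<partial>?P) * ln (\<integral>x. f x \<partial>?P)
      \<le> (s + t) / 2 * (\<integral>x. (norm (G x))\<^sup>2 / f x \<partial>?P) + (d + e)"
    using \<open>0 \<le> t\<close> unfolding E J f(1) Qf_def[symmetric]
    by (simp add: mult_left_mono add_divide_distrib distrib_right)
qed

section \<open>Gaussian measures\<close>

lemma has_bochner_integral_lborel_prod:
  fixes f :: "'a::euclidean_space \<Rightarrow> real \<Rightarrow> real"
  assumes int: "\<And>b. b \<in> Basis \<Longrightarrow> integrable lborel (f b)"
  shows "has_bochner_integral lborel (\<lambda>x::'a. \<Prod>b\<in>Basis. f b (x \<bullet> b)) (\<Prod>b\<in>Basis. \<integral>x. f b x \<partial>lborel)"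
proof -
  have [measurable]: "b \<in> Basis \<Longrightarrow> f b \<in> borel_measurable borel" for b
    using borel_measurable_integrable[OF int] by simp
  interpret product_sigma_finite "\<lambda>b::'a. lborel :: real measure" ..
  show ?thesis
    unfolding has_bochner_integral_iff
    using int product_integrable_prod[of Basis f] product_integral_prod[of Basis f]
    by (subst (1 2) lborel_eq) (simp add: integrable_distr_eq integral_distr)
qed

text \<open>The parameter h is the variance of each coordinate rather than its standard deviation,
  so that parameters add under convolution.\<close>

definition gauss_density :: "real \<Rightarrow> 'a::euclidean_space \<Rightarrow> real" where
  "gauss_density h x = (\<Prod>b\<in>Basis. normal_density 0 (sqrt h) (x \<bullet> b))"

definition gauss :: "real \<Rightarrow> 'a::euclidean_space measure" where
  "gauss h = density lborel (\<lambda>x. ennreal (gauss_density h x))"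

lemma gauss_density_nonneg: "0 \<le> gauss_density h x"
  by (simp add: gauss_density_def prod_nonneg)

lemma measurable_gauss_density [measurable]: "gauss_density h \<in> borel_measurable borel"
  unfolding gauss_density_def by measurable

lemma sets_gauss [measurable_cong, simp]: "sets (gauss h) = sets borel"
  by (simp add: gauss_def)

lemma space_gauss [simp]: "space (gauss h) = UNIV"
  by (simp add: gauss_def)

lemma has_bochner_integral_gauss_prod:
  fixes f :: "'a::euclidean_space \<Rightarrow> real \<Rightarrow> real"
  assumes "\<And>b. b \<in> Basis \<Longrightarrow> f b \<in> borel_measurable borel"
    and "\<And>b. b \<in> Basis \<Longrightarrow> has_bochner_integral lborel (\<lambda>x. normal_density 0 (sqrt h) x * f b x) (I b)"
  shows "has_bochner_integral (gauss h) (\<lambda>x::'a. \<Prod>b\<in>Basis. f b (x \<bullet> b)) (\<Prod>b\<in>Basis. I b)"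
proof -
  note [measurable] = assms(1)
  have "has_bochner_integral lborel (\<lambda>x::'a. \<Prod>b\<in>Basis. normal_density 0 (sqrt h) (x \<bullet> b) * f b (x \<bullet> b))
      (\<Prod>b\<in>Basis. \<integral>x. normal_density 0 (sqrt h) x * f b x \<partial>lborel)"
    using assms(2) by (intro has_bochner_integral_lborel_prod) (blast dest: integrable.intros)
  also have "(\<Prod>b\<in>Basis. \<integral>x. normal_density 0 (sqrt h) x * f b x \<partial>lborel) = (\<Prod>b\<in>Basis. I b)"
    using assms(2) by (intro prod.cong) (auto dest: has_bochner_integral_integral_eq)
  finally show ?thesis
    unfolding gauss_def
    by (intro has_bochner_integral_density)
      (simp_all add: gauss_density_def prod.distrib prod_nonneg)
qed

lemma prob_space_gauss:
  assumes "0 < h"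
  shows "prob_space (gauss h :: 'a::euclidean_space measure)"
proof
  have "has_bochner_integral lborel (normal_density 0 (sqrt h)) 1"
    using assms by (simp add: has_bochner_integral_iff)
  then have "has_bochner_integral (gauss h :: 'a measure) (\<lambda>_. 1 :: real) 1"
    using has_bochner_integral_gauss_prod[of "\<lambda>_ _. 1" h "\<lambda>_::'a. 1"] by simp
  then show "emeasure (gauss h :: 'a measure) (space (gauss h)) = 1"
    using nn_integral_eq_integral[of "gauss h" "\<lambda>_::'a. 1 :: real"]
    by (simp add: has_bochner_integral_iff)
qed

lemma has_bochner_integral_gauss_coordinate:
  fixes i :: "'a::euclidean_space"
  assumes "0 < h" "i \<in> Basis" "f \<in> borel_measurable borel"
    "has_bochner_integral lborel (\<lambda>x. normal_density 0 (sqrt h) x * f x) m"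
  shows "has_bochner_integral (gauss h) (\<lambda>x::'a. f (x \<bullet> i)) m"
proof -
  have "has_bochner_integral lborel (normal_density 0 (sqrt h)) 1"
    using assms by (simp add: has_bochner_integral_iff)
  then have "has_bochner_integral (gauss h) (\<lambda>x::'a. \<Prod>b\<in>Basis. (if b = i then f else (\<lambda>_. 1)) (x \<bullet> b))
     (\<Prod>b\<in>Basis. if b = i then m else 1)"
    using assms by (intro has_bochner_integral_gauss_prod) auto
  then show ?thesis
    using assms by (simp add: if_distrib[where f = "\<lambda>g. g _"] cong: if_cong)
qed

lemma has_bochner_integral_gauss_covariance:
  fixes i j :: "'a::euclidean_space"
  assumes h: "0 < h" and ij: "i \<in> Basis" "j \<in> Basis"
  shows "has_bochner_integral (gauss h) (\<lambda>x::'a. (x \<bullet> i) * (x \<bullet> j)) (if i = j then h else 0)"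
proof (cases "i = j")
  case True
  have "has_bochner_integral lborel (\<lambda>x. normal_density 0 (sqrt h) x * x\<^sup>2) h"
    using normal_moment_even[of "sqrt h" 0 1] h by (simp add: field_simps power2_eq_square)
  then show ?thesis
    using has_bochner_integral_gauss_coordinate[OF h ij(1), of "\<lambda>x. x\<^sup>2" h] True
    by (simp add: power2_eq_square)
next
  case False
  have "has_bochner_integral lborel (normal_density 0 (sqrt h)) 1"
    "has_bochner_integral lborel (\<lambda>x. normal_density 0 (sqrt h) x * x) 0"
    using h normal_moment_odd[of "sqrt h" 0 0] by (simp_all add: has_bochner_integral_iff)
  then have "has_bochner_integral (gauss h) (\<lambda>x::'a. \<Prod>b\<in>Basis. (if b \<in> {i, j} then (\<lambda>x. x) else (\<lambda>_. 1)) (x \<bullet> b))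
     (\<Prod>b\<in>Basis. if b \<in> {i, j} then 0 else 1)"
    by (intro has_bochner_integral_gauss_prod) auto
  moreover have "(\<Prod>b\<in>Basis. (if b \<in> {i, j} then (\<lambda>x. x) else (\<lambda>_. 1)) (x \<bullet> b)) = (x \<bullet> i) * (x \<bullet> j)" for x :: 'a
  proof -
    have "(\<Prod>b\<in>Basis. (if b \<in> {i, j} then (\<lambda>x. x) else (\<lambda>_. 1)) (x \<bullet> b)) = (\<Prod>b\<in>{i, j}. x \<bullet> b)"
      using ij by (intro prod.mono_neutral_cong_right) auto
    then show ?thesis
      using False by simp
  qed
  moreover have "(\<Prod>b\<in>Basis. if b \<in> {i, j} then 0 else 1) = (0::real)"
    using ij by (intro prod_zero) auto
  ultimately show ?thesis
    using False by (simp only: if_False)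
qed

lemma has_bochner_integral_gauss_inner_square:
  fixes v :: "'a::euclidean_space"
  assumes h: "0 < h"
  shows "has_bochner_integral (gauss h) (\<lambda>w. (v \<bullet> w)\<^sup>2) (h * (norm v)\<^sup>2)"
proof -
  have "has_bochner_integral (gauss h)
      (\<lambda>w. \<Sum>i\<in>Basis. \<Sum>j\<in>Basis. ((v \<bullet> i) * (v \<bullet> j)) * ((w \<bullet> i) * (w \<bullet> j)))
      (\<Sum>i\<in>Basis. \<Sum>j\<in>Basis. ((v \<bullet> i) * (v \<bullet> j)) * (if i = j then h else 0))"
    using h by (intro has_bochner_integral_sum has_bochner_integral_mult_right
        has_bochner_integral_gauss_covariance)
  moreover have "(\<Sum>i\<in>Basis. \<Sum>j\<in>Basis. ((v \<bullet> i) * (v \<bullet> j)) * ((w \<bullet> i) * (w \<bullet> j))) = (v \<bullet> w)\<^sup>2" for w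
    by (simp add: euclidean_inner[of v w] power2_eq_square sum_product mult_ac)
  moreover have "(\<Sum>i\<in>Basis. \<Sum>j\<in>Basis. ((v \<bullet> i) * (v \<bullet> j)) * (if i = j then h else 0)) = h * (norm v)\<^sup>2"
    by (simp add: power2_norm_eq_inner euclidean_inner[of v v] sum_distrib_left if_distrib sum.delta mult_ac cong: if_cong)
  ultimately show ?thesis by simp
qed

text \<open>Compares the norm with the largest coordinate, to reduce moments of the norm to
  one-dimensional ones. The constant is crude because it enters only the error term.\<close>

lemma norm_power_le_sum:
  fixes w :: "'a::euclidean_space"
  shows "norm w ^ k \<le> real DIM('a) ^ k * (\<Sum>i\<in>Basis. \<bar>w \<bullet> i\<bar> ^ k)"
proof -
  define m where "m = Max ((\<lambda>i. \<bar>w \<bullet> i\<bar>) ` Basis)"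
  have "m \<in> (\<lambda>i. \<bar>w \<bullet> i\<bar>) ` Basis"
    unfolding m_def by (intro Max_in) auto
  then obtain i where i: "i \<in> Basis" "m = \<bar>w \<bullet> i\<bar>" by auto
  have "norm w \<le> (\<Sum>i\<in>Basis. \<bar>w \<bullet> i\<bar>)"
    by (rule norm_le_l1)
  also have "\<dots> \<le> real DIM('a) * m"
    by (intro sum_bounded_above) (auto simp: m_def)
  finally have "norm w ^ k \<le> (real DIM('a) * m) ^ k"
    by (intro power_mono) auto
  also have "\<dots> \<le> real DIM('a) ^ k * (\<Sum>i\<in>Basis. \<bar>w \<bullet> i\<bar> ^ k)"
    unfolding power_mult_distrib i(2)
    using i by (intro mult_left_mono member_le_sum) auto
  finally show ?thesis .
qed

text \<open>Odd exponents cover the two moments required, the first and the third. What matters is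
  the factor \<open>sqrt h ^ n\<close>.\<close>

lemma gauss_norm_moment:
  fixes k :: nat
  assumes h: "0 < h"
  defines "n \<equiv> 2 * k + 1"
  shows "integrable (gauss h) (\<lambda>w::'a::euclidean_space. norm w ^ n)"
    and "(\<integral>w. norm w ^ n \<partial>(gauss h :: 'a measure))
      \<le> real DIM('a) ^ n * (real DIM('a) * (2 ^ k * fact k * sqrt (2 / pi))) * sqrt h ^ n"
proof -
  have "has_bochner_integral (gauss h)
      (\<lambda>w::'a. real DIM('a) ^ n * (\<Sum>i\<in>Basis. \<bar>w \<bullet> i\<bar> ^ n))
      (real DIM('a) ^ n * (\<Sum>i\<in>(Basis::'a set). 2 ^ k * sqrt h ^ n * fact k * sqrt (2 / pi)))"
    using normal_moment_abs_odd[of "sqrt h" 0 k] h unfolding n_def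
    by (intro has_bochner_integral_mult_right has_bochner_integral_sum
        has_bochner_integral_gauss_coordinate[where f = "\<lambda>x. \<bar>x\<bar> ^ (2 * k + 1)"]) simp_all
  then have int: "integrable (gauss h) (\<lambda>w::'a. real DIM('a) ^ n * (\<Sum>i\<in>Basis. \<bar>w \<bullet> i\<bar> ^ n))"
    and eq: "(\<integral>w. real DIM('a) ^ n * (\<Sum>i\<in>Basis. \<bar>w \<bullet> i\<bar> ^ n) \<partial>(gauss h :: 'a measure))
      = real DIM('a) ^ n * (real DIM('a) * (2 ^ k * fact k * sqrt (2 / pi))) * sqrt h ^ n"
    by (simp_all only: has_bochner_integral_iff) (simp add: mult_ac)
  show norm: "integrable (gauss h) (\<lambda>w::'a. norm w ^ n)"
    using norm_power_le_sum by (intro Bochner_Integration.integrable_bound[OF int]) (auto intro!: AE_I2 order_trans[OF _ abs_ge_self])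
  show "(\<integral>w. norm w ^ n \<partial>(gauss h :: 'a measure))
      \<le> real DIM('a) ^ n * (real DIM('a) * (2 ^ k * fact k * sqrt (2 / pi))) * sqrt h ^ n"
    unfolding eq[symmetric] by (intro integral_mono norm int norm_power_le_sum)
qed

section \<open>Gaussian convolution and the limit of small steps\<close>

lemma gauss_density_convolution:
  fixes z :: "'a::euclidean_space"
  assumes "0 < s" "0 < t"
  shows "(\<integral>\<^sup>+x. ennreal (gauss_density s (z - x) * gauss_density t x) \<partial>lborel) = gauss_density (s + t) z"
proof -
  have "(\<integral>\<^sup>+x. ennreal (gauss_density s (z - x) * gauss_density t x) \<partial>lborel)
      = (\<integral>\<^sup>+x. (\<Prod>b\<in>Basis. ennreal (normal_density 0 (sqrt s) (z \<bullet> b - x \<bullet> b) * normal_density 0 (sqrt t) (x \<bullet> b))) \<partial>lborel)"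
    by (simp add: gauss_density_def prod_ennreal inner_diff_left flip: prod.distrib)
  also have "\<dots> = (\<Prod>b\<in>Basis. \<integral>\<^sup>+x. ennreal (normal_density 0 (sqrt s) (z \<bullet> b - x) * normal_density 0 (sqrt t) x) \<partial>lborel)"
    by (rule nn_integral_lborel_prod[where f = "\<lambda>b x. ennreal (normal_density 0 (sqrt s) (z \<bullet> b - x) * normal_density 0 (sqrt t) x)"]) auto
  also have "\<dots> = (\<Prod>b\<in>Basis. ennreal (normal_density 0 (sqrt (s + t)) (z \<bullet> b)))"
    using conv_normal_density_zero_mean[of "sqrt s" "sqrt t", THEN fun_cong] assms
    by simp
  finally show ?thesis
    by (simp add: gauss_density_def prod_ennreal)
qed

lemma gauss_convolution:
  assumes "0 < s" "0 < t"
  shows "distr (gauss t \<Otimes>\<^sub>M gauss s) borel (\<lambda>(y, x). y + x) = (gauss (s + t) :: 'a::euclidean_space measure)"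
proof (rule measure_eqI)
  fix A :: "'a set" assume "A \<in> sets (distr (gauss t \<Otimes>\<^sub>M gauss s) borel (\<lambda>(y, x). y + x))"
  then have A [measurable]: "A \<in> sets borel" by simp
  interpret S: prob_space "gauss s :: 'a measure" using assms by (intro prob_space_gauss)
  let ?I = "\<lambda>z. indicator A z :: ennreal"
  have "emeasure (distr (gauss t \<Otimes>\<^sub>M gauss s) borel (\<lambda>(y, x). y + x)) A
      = (\<integral>\<^sup>+z. ?I z \<partial>distr (gauss t \<Otimes>\<^sub>M gauss s) borel (\<lambda>(y, x). y + x))"
    by simp
  also have "\<dots> = (\<integral>\<^sup>+y. \<integral>\<^sup>+x. ?I (y + x) \<partial>gauss s \<partial>gauss t)"
    by (subst nn_integral_distr) (simp_all add: S.nn_integral_fst[symmetric])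
  also have "\<dots> = (\<integral>\<^sup>+y. gauss_density t y * (\<integral>\<^sup>+x. gauss_density s x * ?I (y + x) \<partial>lborel) \<partial>lborel)"
    unfolding gauss_def by (simp add: nn_integral_density)
  also have "\<dots> = (\<integral>\<^sup>+y. \<integral>\<^sup>+z. (gauss_density s (z - y) * gauss_density t y) * ?I z \<partial>lborel \<partial>lborel)"
  \<comment> \<open>Translation invariance of Lebesgue measure, with z = y + x, moves y from the
    indicator to the density. After the exchange of integrals the inner one is a convolution of
    densities.\<close>
  proof (rule nn_integral_cong)
    fix y :: 'a
    have "(\<integral>\<^sup>+x. gauss_density s x * ?I (y + x) \<partial>lborel)
        = (\<integral>\<^sup>+x. gauss_density s x * ?I (y + x) \<partial>distr lborel borel ((+) (- y)))"
      by (simp add: lborel_distr_plus)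
    also have "\<dots> = (\<integral>\<^sup>+z. gauss_density s (z - y) * ?I z \<partial>lborel)"
      by (subst nn_integral_distr) simp_all
    finally show "gauss_density t y * (\<integral>\<^sup>+x. gauss_density s x * ?I (y + x) \<partial>lborel)
        = (\<integral>\<^sup>+z. (gauss_density s (z - y) * gauss_density t y) * ?I z \<partial>lborel)"
      by (simp add: nn_integral_cmult[symmetric] ennreal_mult' gauss_density_nonneg mult_ac)
  qed
  also have "\<dots> = (\<integral>\<^sup>+z. \<integral>\<^sup>+y. (gauss_density s (z - y) * gauss_density t y) * ?I z \<partial>lborel \<partial>lborel)"
    by (rule lborel_pair.Fubini') measurable
  also have "\<dots> = (\<integral>\<^sup>+z. gauss_density (s + t) z * ?I z \<partial>lborel)"
    using assms by (simp add: nn_integral_multc gauss_density_convolution)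
  also have "\<dots> = emeasure (gauss (s + t)) A"
    by (simp add: gauss_def emeasure_density)
  finally show "emeasure (distr (gauss t \<Otimes>\<^sub>M gauss s) borel (\<lambda>(y, x). y + x)) A = emeasure (gauss (s + t)) A" .
qed simp

text \<open>C is chosen before h. Both h times the first moment and the third moment are multiples
  of \<open>sqrt h ^ 3\<close>, with moment constants \<open>D 0\<close> and \<open>D 1\<close>;
  their sum serves as a common bound.\<close>

lemma approx_lsi_gauss:
  fixes c B L K :: real
  obtains C where "\<And>h. 0 < h \<Longrightarrow> approx_lsi c B L K (gauss h :: 'a::euclidean_space measure) h (C * sqrt h ^ 3)"
proof
  define D where "D k = real DIM('a) ^ (2 * k + 1) * (real DIM('a) * (2 ^ k * fact k * sqrt (2 / pi)))" for k
  have D: "0 \<le> D k" for k by (simp add: D_def)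
  fix h :: real assume h: "0 < h"
  show "approx_lsi c B L K (gauss h :: 'a measure) h
      ((2 * L * K / c + L ^ 3 / c\<^sup>2) * (D 0 + D 1) * sqrt h ^ 3)"
    unfolding approx_lsi_def
  proof (intro allI impI)
    fix f and G :: "'a \<Rightarrow> 'a" assume "tame c B L K f G"
    then interpret tame_prob c B L K f G "gauss h"
      using prob_space_gauss[OF h] by (simp add: tame_prob_def tame_prob_axioms_def)
    have h3: "sqrt h ^ 3 = h * sqrt h"
      using h by (simp add: power3_eq_cube)
    have "h * (\<integral>w. norm w \<partial>(gauss h :: 'a measure)) \<le> h * (D 0 * sqrt h)"
      using gauss_norm_moment(2)[OF h, of 0, where 'a = 'a] h by (intro mult_left_mono) (simp_all add: D_def)
    also have "\<dots> \<le> (D 0 + D 1) * sqrt h ^ 3"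
      using mult_nonneg_nonneg[OF D[of 1], of "h * sqrt h"] h by (simp add: h3 algebra_simps)
    finally have 1: "h * (\<integral>w. norm w \<partial>(gauss h :: 'a measure)) \<le> (D 0 + D 1) * sqrt h ^ 3" .
    have 3: "(\<integral>w. norm w ^ 3 \<partial>(gauss h :: 'a measure)) \<le> (D 0 + D 1) * sqrt h ^ 3"
      using gauss_norm_moment(2)[OF h, of 1, where 'a = 'a] D[of 0] h
      by (simp add: D_def distrib_right add_increasing)
    show "(\<integral>w. f w * ln (f w) \<partial>gauss h) - (\<integral>w. f w \<partial>gauss h) * ln (\<integral>w. f w \<partial>gauss h)
      \<le> h / 2 * (\<integral>w. (norm (G w))\<^sup>2 / f w \<partial>gauss h)
        + (2 * L * K / c + L ^ 3 / c\<^sup>2) * (D 0 + D 1) * sqrt h ^ 3"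
      using small_step[OF less_imp_le[OF h] has_bochner_integral_gauss_inner_square[OF h] _ 3 _ 1]
        gauss_norm_moment(1)[OF h, of 1, where 'a = 'a] gauss_norm_moment(1)[OF h, of 0, where 'a = 'a]
      by (simp add: mult.assoc)
  qed
qed

lemma tame_lsi_gauss:
  assumes "tame c B L K f (G :: 'a::euclidean_space \<Rightarrow> 'a)"
  shows "(\<integral>w. f w * ln (f w) \<partial>gauss 1) - (\<integral>w. f w \<partial>gauss 1) * ln (\<integral>w. f w \<partial>gauss 1)
      \<le> 1 / 2 * (\<integral>w. (norm (G w))\<^sup>2 / f w \<partial>gauss 1)" (is "?E \<le> ?I")
proof -
  obtain C where C: "\<And>h. 0 < h \<Longrightarrow> approx_lsi c B L K (gauss h :: 'a measure) h (C * sqrt h ^ 3)"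
    by (rule approx_lsi_gauss) blast
  \<comment> \<open>The induction starts from one step, since the formula for \<open>gauss\<close>
    does not give a point mass at variance 0.\<close>
  have steps: "approx_lsi c B L K (gauss (real (Suc k) * h) :: 'a measure) (real (Suc k) * h) (real (Suc k) * (C * sqrt h ^ 3))"
    if h: "0 < h" for h k
  proof (induction k)
    case 0
    then show ?case using C[OF h] by simp
  next
    case (Suc k)
    have pos: "0 < real (Suc k) * h" using h by simp
    have "approx_lsi c B L K (gauss (h + real (Suc k) * h) :: 'a measure) (h + real (Suc k) * h)
        (C * sqrt h ^ 3 + real (Suc k) * (C * sqrt h ^ 3))"
      unfolding gauss_convolution[OF h pos, symmetric]
      by (intro approx_lsi_convolution prob_space_gauss sets_gauss Suc C h pos less_imp_le[OF pos])
    then show ?case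
      by (simp add: algebra_simps)
  qed
  \<comment> \<open>With h = 1 / (k + 1) the variances sum to 1, and k + 1 errors of size C h powr
    (3/2) sum to C sqrt h.\<close>
  have "?E \<le> ?I + C * sqrt (1 / real (Suc k))" for k
  proof -
    have "real (Suc k) * (C * sqrt (1 / real (Suc k)) ^ 3) = C * sqrt (1 / real (Suc k))"
      by (simp add: power3_eq_cube del: of_nat_Suc)
    moreover have "approx_lsi c B L K (gauss 1 :: 'a measure) 1 (real (Suc k) * (C * sqrt (1 / real (Suc k)) ^ 3))"
      using steps[of "1 / real (Suc k)" k] by simp
    ultimately have "approx_lsi c B L K (gauss 1 :: 'a measure) 1 (C * sqrt (1 / real (Suc k)))"
      by (simp only:)
    then show ?thesis
      using assms unfolding approx_lsi_def by blast
  qed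
  moreover have "(\<lambda>k. ?I + C * sqrt (1 / real (Suc k))) \<longlonglongrightarrow> ?I + C * sqrt 0"
    by (intro tendsto_intros lim_1_over_n[THEN LIMSEQ_Suc])
  ultimately show ?thesis
    by (intro LIMSEQ_le_const[where X = "\<lambda>k. ?I + C * sqrt (1 / real (Suc k))"]) auto
qed

section \<open>Calculus of \<open>C_on\<close>\<close>

lemma C_on_SucD: "C_on (Suc k) S f \<Longrightarrow> C_on k S f"
proof (induction k arbitrary: f)
  case 0
  then show ?case
    by (auto intro!: continuous_at_imp_continuous_on differentiable_imp_continuous_within)
next
  case (Suc k)
  have "C_on (Suc k) S (\<lambda>x. frechet_derivative f (at x) v)" for v
    using Suc.prems unfolding C_on.simps(2)[of "Suc k"] by blast
  from Suc.IH[OF this] Suc.prems show ?case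
    unfolding C_on.simps(2)[of k] C_on.simps(2)[of "Suc k"] by blast
qed

lemma C_on_has_derivative:
  "C_on (Suc k) S f \<Longrightarrow> x \<in> S \<Longrightarrow> (f has_derivative frechet_derivative f (at x)) (at x)"
  by (simp flip: frechet_derivative_works)

text \<open>Replaces the chosen \<open>frechet_derivative\<close> in \<open>C_on\<close> by any
  explicit formula for the derivative, so that the rules of calculus can be used in inductions on
  k.\<close>

lemma C_on_SucI:
  assumes "open S" "\<And>x. x \<in> S \<Longrightarrow> (f has_derivative f' x) (at x)" "\<And>v. C_on k S (\<lambda>x. f' x v)"
  shows "C_on (Suc k) S f"
proof -
  have "frechet_derivative f (at x) v = f' x v" if "x \<in> S" for x v
    using frechet_derivative_at[OF assms(2)[OF that]] by simp
  then have "C_on k S (\<lambda>x. frechet_derivative f (at x) v)" for v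
    using assms(3) by (subst C_on_cong_open[OF assms(1)]) auto
  then show ?thesis
    using assms(2) by (auto simp: differentiable_def)
qed

lemma C_on_add:
  assumes "open S"
  shows "C_on k S f \<Longrightarrow> C_on k S g \<Longrightarrow> C_on k S (\<lambda>x. f x + g x)"
proof (induction k arbitrary: f g)
  case 0
  then show ?case by (simp add: continuous_on_add)
next
  case (Suc k)
  show ?case
    by (rule C_on_SucI[OF assms has_derivative_add[OF Suc.prems[THEN C_on_has_derivative]] Suc.IH])
      (use Suc.prems in auto)
qed

lemma C_on_sum:
  assumes "open S" "finite I" "\<And>i. i \<in> I \<Longrightarrow> C_on k S (f i)"
  shows "C_on k S (\<lambda>x. \<Sum>i\<in>I. f i x)"
  using assms(2,3) by (induction I) (simp_all add: C_on_const C_on_add assms(1))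

lemma C_on_scaleR:
  assumes "open S"
  shows "C_on k S f \<Longrightarrow> C_on k S g \<Longrightarrow> C_on k S (\<lambda>x. f x *\<^sub>R g x)"
proof (induction k arbitrary: f g)
  case 0
  then show ?case by (simp add: continuous_on_scaleR)
next
  case (Suc k)
  show ?case
    by (rule C_on_SucI[OF assms has_derivative_scaleR[OF Suc.prems[THEN C_on_has_derivative]]
          C_on_add[OF assms Suc.IH Suc.IH]])
      (use Suc.prems Suc.prems[THEN C_on_SucD] in auto)
qed

lemma C_on_inner_left:
  assumes "open S"
  shows "C_on k S f \<Longrightarrow> C_on k S (\<lambda>x. f x \<bullet> b)"
proof (induction k arbitrary: f)
  case 0
  then show ?case by (simp add: continuous_on_inner)
next
  case (Suc k)
  show ?case
    by (rule C_on_SucI[OF assms has_derivative_inner_left[OF Suc.prems[THEN C_on_has_derivative]] Suc.IH])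
      (use Suc.prems in auto)
qed

lemma C_on_compose:
  fixes f :: "'b::euclidean_space \<Rightarrow> 'c::real_normed_vector"
  assumes S: "open S" and T: "open T" and "g ` S \<subseteq> T"
  shows "C_on k S g \<Longrightarrow> C_on k T f \<Longrightarrow> C_on k S (f \<circ> g)"
proof (induction k arbitrary: f)
  case 0
  then show ?case
    using assms(3) continuous_on_compose2[of T f S g] by (simp add: o_def)
next
  case (Suc k)
  show ?case
  proof (rule C_on_SucI[OF S])
    fix x assume x: "x \<in> S"
    let ?g' = "frechet_derivative g (at x)" and ?f' = "frechet_derivative f (at (g x))"
    have f': "(f has_derivative ?f') (at (g x))"
      using Suc.prems(2) assms(3) x by (intro C_on_has_derivative) auto
    have chain: "(f \<circ> g has_derivative ?f' \<circ> ?g') (at x)"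
      by (rule diff_chain_at[OF C_on_has_derivative[OF Suc.prems(1) x] f'])
    \<comment> \<open>The chain rule differentiates f in the direction \<open>?g' v\<close>, which
      varies with x, whereas \<open>C_on\<close> speaks of fixed directions only. Expanding in the
      basis separates the two and leaves sums of products, to which the induction hypothesis
      applies.\<close>
    have expand: "?f' y = (\<Sum>b\<in>Basis. (y \<bullet> b) *\<^sub>R ?f' b)" for y
    proof -
      interpret linear ?f' by (rule has_derivative_linear[OF f'])
      have "?f' y = ?f' (\<Sum>b\<in>Basis. (y \<bullet> b) *\<^sub>R b)"
        by (simp add: euclidean_representation)
      then show ?thesis
        by (simp only: sum scale)
    qed
    have eq: "?f' \<circ> ?g' = (\<lambda>v. \<Sum>b\<in>Basis. (?g' v \<bullet> b) *\<^sub>R ?f' b)"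
      by (rule ext, unfold o_apply, rule expand)
    show "(f \<circ> g has_derivative (\<lambda>v. \<Sum>b\<in>Basis. (?g' v \<bullet> b) *\<^sub>R ?f' b)) (at x)"
      using chain unfolding eq .
  next
    fix v
    have "C_on k S ((\<lambda>y. frechet_derivative f (at y) b) \<circ> g)" for b
      using Suc.prems(2) by (intro Suc.IH C_on_SucD[OF Suc.prems(1)]) simp
    then show "C_on k S (\<lambda>x. \<Sum>b\<in>Basis. (frechet_derivative g (at x) v \<bullet> b) *\<^sub>R frechet_derivative f (at (g x)) b)"
      using Suc.prems(1) by (intro C_on_sum C_on_scaleR C_on_inner_left S) (simp_all add: o_def)
  qed
qed

lemma smooth_on_compose:
  fixes f :: "'b::euclidean_space \<Rightarrow> 'c::real_normed_vector"
  assumes "open S" "open T" "g ` S \<subseteq> T" "smooth_on S g" "smooth_on T f"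
  shows "smooth_on S (f \<circ> g)"
  unfolding smooth_on_def
proof
  fix k show "C_on k S (f \<circ> g)"
    using assms by (intro C_on_compose[of S T]) (auto simp: smooth_on_def)
qed

section \<open>Localisation of smoothness, and bounds on balls\<close>

lemma C_on_local:
  assumes "\<And>x. x \<in> S \<Longrightarrow> \<exists>T. open T \<and> x \<in> T \<and> C_on k T f"
  shows "C_on k S f"
  using assms
proof (induction k arbitrary: f)
  case 0
  have "continuous_on S f"
  proof (rule continuous_at_imp_continuous_on, rule ballI)
    fix x assume "x \<in> S"
    from 0[OF this] obtain T where "open T" "x \<in> T" "continuous_on T f"
      by auto
    then show "continuous (at x) f"
      by (simp add: continuous_on_eq_continuous_at)
  qed
  then show ?case by simp
next
  case (Suc k)
  have "C_on k S (\<lambda>x. frechet_derivative f (at x) v)" for v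
  proof (rule Suc.IH)
    fix x assume "x \<in> S"
    from Suc.prems[OF this] obtain T where "open T" "x \<in> T" "C_on (Suc k) T f"
      by blast
    then show "\<exists>T. open T \<and> x \<in> T \<and> C_on k T (\<lambda>x. frechet_derivative f (at x) v)"
      by (intro exI[of _ T]) simp
  qed
  moreover have "f differentiable (at x)" if x: "x \<in> S" for x
  proof -
    from Suc.prems[OF x] obtain T where "x \<in> T" "C_on (Suc k) T f"
      by blast
    then show ?thesis by simp
  qed
  ultimately show ?case by simp
qed

lemma smooth_on_local:
  assumes "\<And>x. x \<in> S \<Longrightarrow> \<exists>T. open T \<and> x \<in> T \<and> smooth_on T f"
  shows "smooth_on S f"
  unfolding smooth_on_def
proof
  fix k show "C_on k S f"
  proof (rule C_on_local)
    fix x assume "x \<in> S"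
    from assms[OF this] obtain T where "open T" "x \<in> T" "smooth_on T f"
      by blast
    then show "\<exists>T. open T \<and> x \<in> T \<and> C_on k T f"
      by (intro exI[of _ T]) (simp add: smooth_on_def)
  qed
qed

lemma C_on_bounded_cball:
  assumes "C_on k UNIV (f :: 'a::euclidean_space \<Rightarrow> 'b::real_normed_vector)"
  shows "\<exists>M\<ge>0. \<forall>x\<in>cball 0 R. norm (f x) \<le> M"
proof -
  have "continuous_on UNIV f"
    using assms by (induction k) (simp, blast dest: C_on_SucD)
  then have "bounded (f ` cball 0 R)"
    by (intro compact_imp_bounded compact_continuous_image) (auto intro: continuous_on_subset)
  then show ?thesis
    unfolding bounded_pos by (auto intro: less_imp_le)
qed

text \<open>The partial derivatives are bounded on the compact ball, their bounds add up to a bound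
  on the operator norm, and the mean value inequality applies because the ball is convex.\<close>

lemma C_on_lipschitz_cball:
  assumes "C_on (Suc 0) UNIV (f :: 'a::euclidean_space \<Rightarrow> 'b::real_normed_vector)"
  shows "\<exists>C\<ge>0. \<forall>x\<in>cball 0 R. \<forall>y\<in>cball 0 R. norm (f x - f y) \<le> C * norm (x - y)"
proof -
  let ?f' = "\<lambda>x. frechet_derivative f (at x)"
  have "\<exists>M\<ge>0. \<forall>x\<in>cball 0 R. norm (?f' x b) \<le> M" for b
    using assms by (intro C_on_bounded_cball[where k = 0]) auto
  then obtain M where M: "\<And>b. 0 \<le> M b" "\<And>b x. x \<in> cball 0 R \<Longrightarrow> norm (?f' x b) \<le> M b"
    by metis
  have "norm (f x - f y) \<le> (\<Sum>b\<in>Basis. M b) * norm (x - y)" if "x \<in> cball 0 R" "y \<in> cball 0 R" for x y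
  proof (rule differentiable_bound[OF convex_cball _ _ that])
    fix z :: 'a assume z: "z \<in> cball 0 R"
    have d: "(f has_derivative ?f' z) (at z)"
      by (rule C_on_has_derivative[OF assms UNIV_I])
    then show "(f has_derivative ?f' z) (at z within cball 0 R)"
      by (rule has_derivative_at_withinI)
    show "onorm (?f' z) \<le> (\<Sum>b\<in>Basis. M b)"
      by (rule order_trans[OF onorm_componentwise[OF has_derivative_bounded_linear[OF d]] sum_mono])
        (rule M(2)[OF z])
  qed
  then show ?thesis
    using M(1) by (intro exI[of _ "\<Sum>b\<in>Basis. M b"]) (auto simp: sum_nonneg)
qed

section \<open>Cutting off\<close>

lemma tame_of_derivative:
  fixes f :: "'a::euclidean_space \<Rightarrow> real"
  assumes "0 < c" "0 \<le> K" "\<And>x. c \<le> f x" "\<And>x. f x \<le> B"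
    and deriv: "\<And>x. (f has_derivative (\<lambda>v. G x \<bullet> v)) (at x)"
    and L: "\<And>x. norm (G x) \<le> L" and K: "\<And>x y. norm (G x - G y) \<le> K * norm (x - y)"
  shows "tame c B L K f G"
proof
  have onorm: "onorm (\<lambda>v. z \<bullet> v) \<le> norm z" for z :: 'a
    by (rule onorm_bound) (use Cauchy_Schwarz_ineq2[of z] in \<open>simp_all only: real_norm_def norm_ge_zero\<close>)
  fix x w
  show "norm (G (x + w) - G x) \<le> K * norm w"
    using K[of "x + w" x] by simp
  have "norm (f (x + w) - f x) \<le> L * norm (x + w - x)"
    using deriv order_trans[OF onorm L]
    by (intro differentiable_bound[where S = UNIV and f' = "\<lambda>x. (\<bullet>) (G x)"]) simp_all
  then show "\<bar>f (x + w) - f x\<bar> \<le> L * norm w"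
    by simp
  \<comment> \<open>Along the segment the derivative differs from the one at x by at most
    \<open>K * norm w\<close>; the mean value inequality for f minus its linear part gives the
    second factor \<open>norm w\<close>.\<close>
  have "norm (f (x + w) - f x - G x \<bullet> (x + w - x)) \<le> norm (x + w - x) * (K * norm w)"
  proof (rule differentiable_bound_linearization[where S = "closed_segment x (x + w)"
        and f' = "\<lambda>x. (\<bullet>) (G x)" and ?x0.0 = x])
    show "x + t *\<^sub>R (x + w - x) \<in> closed_segment x (x + w)" if "t \<in> {0..1}" for t
    proof -
      have "x + t *\<^sub>R (x + w - x) = (1 - t) *\<^sub>R x + t *\<^sub>R (x + w)"
        by (simp add: scaleR_left_diff_distrib scaleR_right_distrib)
      then show ?thesis
        using that unfolding closed_segment_def by (simp only: mem_Collect_eq) auto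
    qed
    fix z assume z: "z \<in> closed_segment x (x + w)"
    show "(f has_derivative (\<lambda>v. G z \<bullet> v)) (at z within closed_segment x (x + w))"
      by (rule has_derivative_at_withinI[OF deriv])
    have "norm (z - x) \<le> norm w"
      using segment_bound(1)[OF z] by simp
    then have "norm (G z - G x) \<le> K * norm w"
      by (rule order_trans[OF K mult_left_mono[OF _ \<open>0 \<le> K\<close>]])
    moreover have "(\<bullet>) (G z) - (\<bullet>) (G x) = (\<bullet>) (G z - G x)"
      by (simp add: fun_eq_iff inner_diff_left)
    ultimately show "onorm ((\<bullet>) (G z) - (\<bullet>) (G x)) \<le> K * norm w"
      using order_trans[OF onorm[of "G z - G x"]] by (simp only:)
  qed simp
  then show "\<bar>f (x + w) - f x - G x \<bullet> w\<bar> \<le> K * (norm w)\<^sup>2"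
    by (simp add: power2_eq_square mult_ac)
qed (fact assms)+

text \<open>Test functions are multiplied by the square \<open>u\<^sup>2\<close> of the cutoff, because
  \<open>|\<nabla>(u\<^sup>2)|\<^sup>2 / u\<^sup>2 = 4 |\<nabla>u|\<^sup>2\<close> is bounded although \<open>u\<close> vanishes outside a ball.\<close>

definition cutoff :: "real \<Rightarrow> 'a::euclidean_space \<Rightarrow> real" where
  "cutoff R x = max 0 (1 - (norm x)\<^sup>2 / R\<^sup>2)"

lemma cutoff_bounds: "0 \<le> cutoff R x" "cutoff R x \<le> 1"
  by (auto simp: cutoff_def)

lemma cutoff_outside:
  assumes "0 < R" "x \<notin> cball 0 R"
  shows "cutoff R x = 0"
proof -
  have "R\<^sup>2 \<le> (norm x)\<^sup>2"
    using assms by (intro power_mono) auto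
  then have "1 \<le> (norm x)\<^sup>2 / R\<^sup>2"
    using assms(1) by simp
  then show ?thesis
    by (simp add: cutoff_def)
qed

text \<open>As a function of the radius clipped to [0, R], the cutoff is a plain parabola, and its
  Lipschitz constant follows from a difference of squares.\<close>

lemma cutoff_eq_min:
  assumes "0 < R"
  shows "cutoff R x = 1 - (min R (norm x))\<^sup>2 / R\<^sup>2"
proof (cases "x \<in> cball 0 R")
  case True
  then have "(norm x)\<^sup>2 \<le> R\<^sup>2"
    by (intro power_mono) auto
  then have "(norm x)\<^sup>2 / R\<^sup>2 \<le> 1"
    using assms by simp
  then show ?thesis
    using True by (simp add: cutoff_def min_absorb2)
next
  case False
  then show ?thesis
    using assms by (simp add: cutoff_outside[OF assms False] min_absorb1)
qed

lemma lipschitz_cutoff: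
  assumes R: "0 < R"
  shows "\<bar>cutoff R x - cutoff R y\<bar> \<le> 2 / R * norm (x - y)"
proof -
  define a b where "a = min R (norm x)" and "b = min R (norm y)"
  have ab: "0 \<le> a" "a \<le> R" "0 \<le> b" "b \<le> R"
    using R by (auto simp: a_def b_def)
  have "\<bar>a - b\<bar> \<le> \<bar>norm x - norm y\<bar>"
    by (auto simp: a_def b_def min_def)
  then have d: "\<bar>b - a\<bar> \<le> norm (x - y)"
    using norm_triangle_ineq3[of x y] by linarith
  have "cutoff R x - cutoff R y = (b - a) * (a + b) / R\<^sup>2"
    unfolding cutoff_eq_min[OF R] a_def[symmetric] b_def[symmetric]
    by (simp add: algebra_simps power2_eq_square diff_divide_distrib add_divide_distrib)
  then have "\<bar>cutoff R x - cutoff R y\<bar> = \<bar>(b - a) * (a + b)\<bar> / R\<^sup>2"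
    by (simp add: abs_mult)
  also have "\<dots> \<le> norm (x - y) * (2 * R) / R\<^sup>2"
    unfolding abs_mult using ab d by (intro divide_right_mono mult_mono) auto
  finally show ?thesis
    using R by (simp add: power2_eq_square field_simps)
qed

text \<open>W is controlled on the ball only, yet the product is Lipschitz everywhere. If one point
  lies in the ball, the difference is split so that W is bounded at that point; at the other point W
  is either controlled as well or multiplied by 0.\<close>

lemma lipschitz_cutoff_scaleR:
  fixes W :: "'a::euclidean_space \<Rightarrow> 'b::real_normed_vector"
  assumes R: "0 < R" and C: "0 \<le> C"
    and W: "\<And>x. x \<in> cball 0 R \<Longrightarrow> norm (W x) \<le> M"
      "\<And>x y. x \<in> cball 0 R \<Longrightarrow> y \<in> cball 0 R \<Longrightarrow> norm (W x - W y) \<le> C * norm (x - y)"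
  shows "norm (cutoff R x *\<^sub>R W x - cutoff R y *\<^sub>R W y) \<le> (C + 2 / R * M) * norm (x - y)"
proof -
  have M: "0 \<le> M"
    using order_trans[OF norm_ge_zero W(1)[of 0]] R by simp
  have one: "norm (cutoff R x *\<^sub>R W x - cutoff R y *\<^sub>R W y) \<le> (C + 2 / R * M) * norm (x - y)"
    if y: "y \<in> cball 0 R" for x y
  proof -
    have "cutoff R x *\<^sub>R W x - cutoff R y *\<^sub>R W y = cutoff R x *\<^sub>R (W x - W y) + (cutoff R x - cutoff R y) *\<^sub>R W y"
      by (simp add: algebra_simps)
    also have "norm \<dots> \<le> cutoff R x * norm (W x - W y) + \<bar>cutoff R x - cutoff R y\<bar> * norm (W y)"
      by (rule norm_triangle_le) (simp add: cutoff_bounds)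
    also have "cutoff R x * norm (W x - W y) \<le> C * norm (x - y)"
    proof (cases "x \<in> cball 0 R")
      case True
      then show ?thesis
        using mult_mono[OF cutoff_bounds(2)[of R x] W(2)[OF True y]] by (simp add: cutoff_bounds)
    next
      case False
      then show ?thesis
        using C by (simp add: cutoff_outside[OF R False])
    qed
    also have "\<bar>cutoff R x - cutoff R y\<bar> * norm (W y) \<le> (2 / R * norm (x - y)) * M"
      using R M W(1)[OF y] by (intro mult_mono lipschitz_cutoff) auto
    finally show ?thesis
      by (simp add: algebra_simps)
  qed
  consider "x \<in> cball 0 R" | "y \<in> cball 0 R" | "x \<notin> cball 0 R" "y \<notin> cball 0 R" by blast
  then show ?thesis
  proof cases
    case 1
    then show ?thesis using one[of x y] by (simp add: norm_minus_commute)
  next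
    case 3
    then show ?thesis using R C M by (simp add: cutoff_outside[OF R 3(1)] cutoff_outside[OF R 3(2)])
  qed (rule one)
qed

lemma norm_cutoff_scaleR_le:
  assumes R: "0 < R" and "0 \<le> M" and W: "\<And>x. x \<in> cball 0 R \<Longrightarrow> norm (W x) \<le> M"
  shows "norm (cutoff R x *\<^sub>R W x) \<le> M"
proof (cases "x \<in> cball 0 R")
  case True
  then show ?thesis
    using mult_mono[OF cutoff_bounds(2)[of R x] W[OF True]] by (simp add: cutoff_bounds)
next
  case False
  then show ?thesis
    using \<open>0 \<le> M\<close> by (simp add: cutoff_outside[OF R False])
qed

text \<open>Squaring removes the kink of the positive part: at 0 the difference quotient is at most
  |h|. Thus the squared cutoff is differentiable also on the sphere where it reaches 0.\<close>

lemma DERIV_max_0_square: "((\<lambda>r. (max 0 r)\<^sup>2) has_real_derivative 2 * max 0 r) (at (r::real))"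
proof -
  consider "r < 0" | "r = 0" | "0 < r" by linarith
  then show ?thesis
  proof cases
    case 1
    have "((\<lambda>_. 0) has_real_derivative 2 * max 0 r) (at r)"
      using 1 by simp
    then show ?thesis
      by (rule has_field_derivative_transform_within_open[where S = "{..<0}"]) (use 1 in auto)
  next
    case 2
    have "((\<lambda>h. (max 0 h)\<^sup>2 / h) \<longlongrightarrow> 0) (at (0::real))"
    proof (rule Lim_null_comparison)
      show "\<forall>\<^sub>F h in at (0::real). norm ((max 0 h)\<^sup>2 / h) \<le> \<bar>h\<bar>"
        by (rule always_eventually) (auto simp: max_def power2_eq_square)
      show "((\<lambda>h::real. \<bar>h\<bar>) \<longlongrightarrow> 0) (at 0)"
        by (rule tendsto_rabs_zero) (rule tendsto_ident_at)
    qed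
    then show ?thesis
      using 2 by (simp add: DERIV_def)
  next
    case 3
    have "((\<lambda>r. r\<^sup>2) has_real_derivative 2 * max 0 r) (at r)"
      using 3 by (auto intro!: derivative_eq_intros)
    then show ?thesis
      by (rule has_field_derivative_transform_within_open[where S = "{0<..}"]) (use 3 in auto)
  qed
qed

lemma has_derivative_cutoff_square:
  "((\<lambda>x. (cutoff R x)\<^sup>2) has_derivative (\<lambda>v. (- (4 * cutoff R x / R\<^sup>2)) * (x \<bullet> v))) (at x)"
proof -
  have "((\<lambda>x. 1 - inverse (R\<^sup>2) * (x \<bullet> x)) has_derivative (\<lambda>v. - (inverse (R\<^sup>2) * (2 * (x \<bullet> v))))) (at x)"
    by (auto intro!: derivative_eq_intros simp: inner_commute)
  from diff_chain_at[OF this DERIV_max_0_square[THEN has_field_derivative_imp_has_derivative]]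
  show ?thesis
    by (simp add: o_def cutoff_def power2_norm_eq_inner divide_inverse mult_ac)
qed

text \<open>The weight \<delta> keeps the coefficient of the main term near 1, which preserves the
  sharp constant; the large factor falls on the term coming from the gradient of the cutoff.\<close>

lemma norm_add_square_le:
  fixes a b :: "'a::real_inner"
  assumes \<delta>: "0 < \<delta>"
  shows "(norm (a + b))\<^sup>2 \<le> (1 + \<delta>) * (norm a)\<^sup>2 + (1 + 1 / \<delta>) * (norm b)\<^sup>2"
proof -
  have "0 \<le> (norm (\<delta> *\<^sub>R a - b))\<^sup>2 / \<delta>"
    using \<delta> by simp
  also have "\<dots> = \<delta> * (norm a)\<^sup>2 + 1 / \<delta> * (norm b)\<^sup>2 - 2 * (a \<bullet> b)"
    unfolding power2_norm_eq_inner using \<delta> by (simp add: inner_diff inner_commute field_simps)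
  finally show ?thesis
    unfolding power2_norm_eq_inner by (simp add: inner_add inner_commute algebra_simps)
qed

text \<open>Adding \<epsilon> supplies the positive lower bound, and compactness of the ball
  supplies the others. B, L and K depend on R and \<epsilon> without control, which is harmless
  because the inequality for tame functions under \<open>gauss 1\<close> does not contain
  them.\<close>

lemma tame_cutoff:
  fixes g :: "'a::euclidean_space \<Rightarrow> real"
  assumes g: "C_on (Suc 0) UNIV g" "\<And>x. 0 < g x" and \<Gamma>: "C_on (Suc 0) UNIV \<Gamma>"
    and deriv: "\<And>x. (g has_derivative (\<lambda>v. \<Gamma> x \<bullet> v)) (at x)"
    and R: "0 < R" and \<epsilon>: "0 < \<epsilon>"
  obtains B L K where "tame \<epsilon> B L K (\<lambda>x. (cutoff R x)\<^sup>2 * g x + \<epsilon>)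
    (\<lambda>x. (cutoff R x)\<^sup>2 *\<^sub>R \<Gamma> x - (4 * cutoff R x * g x / R\<^sup>2) *\<^sub>R x)"
proof -
  let ?u = "cutoff R :: 'a \<Rightarrow> real"
  \<comment> \<open>The squared cutoff has gradient -4 u x / R^2, so the gradient of the product
    combines u^2 \<Gamma> with u W.\<close>
  define W where "W x = g x *\<^sub>R x" for x
  have "C_on (Suc 0) UNIV (\<lambda>x::'a. x)"
    using smooth_on_id by (auto simp: smooth_on_def id_def simp del: C_on.simps)
  then have W: "C_on (Suc 0) UNIV W"
    unfolding W_def by (intro C_on_scaleR g) auto
  obtain Mg where Mg: "0 \<le> Mg" "\<And>x. x \<in> cball 0 R \<Longrightarrow> norm (g x) \<le> Mg"
    using C_on_bounded_cball[OF g(1)] by blast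
  obtain M\<Gamma> where M\<Gamma>: "0 \<le> M\<Gamma>" "\<And>x. x \<in> cball 0 R \<Longrightarrow> norm (\<Gamma> x) \<le> M\<Gamma>"
    using C_on_bounded_cball[OF \<Gamma>(1)] by blast
  obtain MW where MW: "0 \<le> MW" "\<And>x. x \<in> cball 0 R \<Longrightarrow> norm (W x) \<le> MW"
    using C_on_bounded_cball[OF W(1)] by blast
  obtain C\<Gamma> where C\<Gamma>: "0 \<le> C\<Gamma>"
    "\<And>x y. x \<in> cball 0 R \<Longrightarrow> y \<in> cball 0 R \<Longrightarrow> norm (\<Gamma> x - \<Gamma> y) \<le> C\<Gamma> * norm (x - y)"
    using C_on_lipschitz_cball[OF \<Gamma>(1)] by blast
  obtain CW where CW: "0 \<le> CW"
    "\<And>x y. x \<in> cball 0 R \<Longrightarrow> y \<in> cball 0 R \<Longrightarrow> norm (W x - W y) \<le> CW * norm (x - y)"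
    using C_on_lipschitz_cball[OF W(1)] by blast
  define C1 where "C1 = C\<Gamma> + 2 / R * M\<Gamma>"
  \<comment> \<open>The term with two cutoff factors is treated by applying the Lipschitz estimate
    twice; C1 belongs to the first application.\<close>
  define C2 where "C2 = C1 + 2 / R * M\<Gamma>"
  define C3 where "C3 = CW + 2 / R * MW"
  have C1: "0 \<le> C1" and C2: "0 \<le> C2" and C3: "0 \<le> C3"
    using R C\<Gamma>(1) M\<Gamma>(1) CW(1) MW(1) by (auto simp: C1_def C2_def C3_def)
  have u\<Gamma>: "norm (?u x *\<^sub>R \<Gamma> x) \<le> M\<Gamma>" for x
    by (intro norm_cutoff_scaleR_le R M\<Gamma>)
  have uu\<Gamma>: "norm (?u x *\<^sub>R ?u x *\<^sub>R \<Gamma> x) \<le> M\<Gamma>" for x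
    by (rule norm_cutoff_scaleR_le[OF R M\<Gamma>(1) u\<Gamma>])
  have uW: "norm (?u x *\<^sub>R W x) \<le> MW" for x
    by (rule norm_cutoff_scaleR_le[OF R MW])
  have ug: "norm (?u x *\<^sub>R g x) \<le> Mg" for x
    by (rule norm_cutoff_scaleR_le[OF R Mg])
  have uug: "norm (?u x *\<^sub>R ?u x *\<^sub>R g x) \<le> Mg" for x
    by (rule norm_cutoff_scaleR_le[OF R Mg(1) ug])
  have lip1: "norm (?u x *\<^sub>R \<Gamma> x - ?u y *\<^sub>R \<Gamma> y) \<le> C1 * norm (x - y)" for x y
    unfolding C1_def by (intro lipschitz_cutoff_scaleR R C\<Gamma> M\<Gamma>)
  have lip2: "norm (?u x *\<^sub>R ?u x *\<^sub>R \<Gamma> x - ?u y *\<^sub>R ?u y *\<^sub>R \<Gamma> y) \<le> C2 * norm (x - y)" for x y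
    unfolding C2_def by (intro lipschitz_cutoff_scaleR R C1 u\<Gamma> lip1)
  have lip3: "norm (?u x *\<^sub>R W x - ?u y *\<^sub>R W y) \<le> C3 * norm (x - y)" for x y
    unfolding C3_def by (intro lipschitz_cutoff_scaleR R CW MW)
  define G where "G x = ?u x *\<^sub>R ?u x *\<^sub>R \<Gamma> x - (4 / R\<^sup>2) *\<^sub>R ?u x *\<^sub>R W x" for x
  have "tame \<epsilon> (Mg + \<epsilon>) (M\<Gamma> + 4 / R\<^sup>2 * MW) (C2 + 4 / R\<^sup>2 * C3) (\<lambda>x. (?u x)\<^sup>2 * g x + \<epsilon>) G"
  proof (rule tame_of_derivative)
    fix x y :: 'a
    show "0 < \<epsilon>" by fact
    show "0 \<le> C2 + 4 / R\<^sup>2 * C3"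
      using C2 C3 by simp
    show "\<epsilon> \<le> (?u x)\<^sup>2 * g x + \<epsilon>"
      using g(2)[of x] by simp
    show "(?u x)\<^sup>2 * g x + \<epsilon> \<le> Mg + \<epsilon>"
      using uug[of x] g(2)[of x] cutoff_bounds(1)[of R x] by (simp add: power2_eq_square mult.assoc)
    show "((\<lambda>x. (?u x)\<^sup>2 * g x + \<epsilon>) has_derivative (\<lambda>v. G x \<bullet> v)) (at x)"
      by (rule has_derivative_eq_rhs[OF has_derivative_add[OF
              has_derivative_mult[OF has_derivative_cutoff_square deriv] has_derivative_const]])
        (simp add: G_def W_def inner_diff_left fun_eq_iff power2_eq_square mult_ac)
    have "norm (G x) \<le> norm (?u x *\<^sub>R ?u x *\<^sub>R \<Gamma> x) + norm ((4 / R\<^sup>2) *\<^sub>R ?u x *\<^sub>R W x)"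
      unfolding G_def by (rule norm_triangle_ineq4)
    also have "\<dots> \<le> M\<Gamma> + 4 / R\<^sup>2 * MW"
      using uu\<Gamma>[of x] mult_left_mono[OF uW[of x], of "4 / R\<^sup>2"]
      by (intro add_mono) (simp_all add: abs_mult)
    finally show "norm (G x) \<le> M\<Gamma> + 4 / R\<^sup>2 * MW" .
    have "G x - G y = (?u x *\<^sub>R ?u x *\<^sub>R \<Gamma> x - ?u y *\<^sub>R ?u y *\<^sub>R \<Gamma> y)
        - (4 / R\<^sup>2) *\<^sub>R (?u x *\<^sub>R W x - ?u y *\<^sub>R W y)"
      by (simp add: G_def algebra_simps)
    also have "norm \<dots> \<le> C2 * norm (x - y) + 4 / R\<^sup>2 * (C3 * norm (x - y))"
      using mult_left_mono[OF lip3[of x y], of "4 / R\<^sup>2"] lip2[of x y]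
      by (intro order_trans[OF norm_triangle_ineq4 add_mono]) simp_all
    finally show "norm (G x - G y) \<le> (C2 + 4 / R\<^sup>2 * C3) * norm (x - y)"
      by (simp add: algebra_simps)
  qed
  moreover have "G = (\<lambda>x. (?u x)\<^sup>2 *\<^sub>R \<Gamma> x - (4 * ?u x * g x / R\<^sup>2) *\<^sub>R x)"
    by (simp add: G_def W_def fun_eq_iff power2_eq_square mult_ac)
  ultimately show ?thesis
    using that by blast
qed

text \<open>Both terms of the squared gradient contain the factor \<open>u\<^sup>2 * g x\<close>,
  which the denominator dominates, so the bound is free of \<epsilon>. Where u is nonzero,
  \<open>norm x\<close> is at most R, and 16 |x|^2 / R^4 shrinks to 16 / R^2.\<close>

lemma fisher_cutoff_le:
  fixes g :: "'a::euclidean_space \<Rightarrow> real" and \<Gamma> :: "'a \<Rightarrow> 'a"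
  assumes g: "0 < g x" and R: "0 < R" and \<epsilon>: "0 < \<epsilon>" and \<delta>: "0 < \<delta>"
  shows "(norm ((cutoff R x)\<^sup>2 *\<^sub>R \<Gamma> x - (4 * cutoff R x * g x / R\<^sup>2) *\<^sub>R x))\<^sup>2 / ((cutoff R x)\<^sup>2 * g x + \<epsilon>)
    \<le> (1 + \<delta>) * ((norm (\<Gamma> x))\<^sup>2 / g x) + (1 + 1 / \<delta>) * (16 / R\<^sup>2) * g x"
proof (cases "cutoff R x = 0")
  case True
  then show ?thesis using assms by (auto intro!: add_nonneg_nonneg mult_nonneg_nonneg)
next
  case False
  define u where "u = cutoff R x"
  have u: "0 < u" "u \<le> 1"
    using False cutoff_bounds[of R x] by (auto simp: u_def)
  have x: "norm x \<le> R"
    using cutoff_outside[OF R] False by auto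
  have "(norm (u\<^sup>2 *\<^sub>R \<Gamma> x - (4 * u * g x / R\<^sup>2) *\<^sub>R x))\<^sup>2
      \<le> (1 + \<delta>) * (norm (u\<^sup>2 *\<^sub>R \<Gamma> x))\<^sup>2 + (1 + 1 / \<delta>) * (norm (- ((4 * u * g x / R\<^sup>2) *\<^sub>R x)))\<^sup>2"
    using norm_add_square_le[OF \<delta>, of "u\<^sup>2 *\<^sub>R \<Gamma> x" "- ((4 * u * g x / R\<^sup>2) *\<^sub>R x)"] by simp
  also have "\<dots> = u\<^sup>2 * g x * ((1 + \<delta>) * (u\<^sup>2 * ((norm (\<Gamma> x))\<^sup>2 / g x)) + (1 + 1 / \<delta>) * (16 * (norm x)\<^sup>2 / R ^ 4) * g x)"
    using g R by (simp add: field_simps power2_eq_square power4_eq_xxxx)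
  also have "\<dots> \<le> u\<^sup>2 * g x * ((1 + \<delta>) * ((norm (\<Gamma> x))\<^sup>2 / g x) + (1 + 1 / \<delta>) * (16 / R\<^sup>2) * g x)"
  proof (intro mult_left_mono add_mono mult_right_mono)
    show "u\<^sup>2 * ((norm (\<Gamma> x))\<^sup>2 / g x) \<le> (norm (\<Gamma> x))\<^sup>2 / g x"
      using u g by (intro mult_left_le_one_le) (auto simp: power_le_one)
    have "16 * (norm x)\<^sup>2 / R ^ 4 \<le> 16 * R\<^sup>2 / R ^ 4"
      using x R by (intro divide_right_mono mult_left_mono power_mono) auto
    then show "16 * (norm x)\<^sup>2 / R ^ 4 \<le> 16 / R\<^sup>2"
      using R by (simp add: power2_eq_square power4_eq_xxxx)
  qed (use u g \<delta> in auto)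
  also have "\<dots> \<le> (u\<^sup>2 * g x + \<epsilon>) * ((1 + \<delta>) * ((norm (\<Gamma> x))\<^sup>2 / g x) + (1 + 1 / \<delta>) * (16 / R\<^sup>2) * g x)"
    using \<epsilon> \<delta> g by (intro mult_right_mono add_nonneg_nonneg mult_nonneg_nonneg) auto
  finally show ?thesis
    using u g \<epsilon> unfolding u_def[symmetric]
    by (subst pos_divide_le_eq) (auto simp: mult_ac add_pos_pos)
qed

section \<open>The Gaussian logarithmic Sobolev inequality\<close>

lemma x_ln_x_ge: "0 \<le> x * ln x + 1" if "0 \<le> x" for x :: real
proof (cases "x = 0")
  case False
  then show ?thesis
    using x_ln_x_ge_tangent[of 1 x] that by simp
qed simp

section \<open>Extended integrals and gradients\<close>

lemma ext_integral_eq_integral: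
  assumes "integrable M h"
  shows "ext_integral M h = ereal (\<integral>x. h x \<partial>M)"
proof -
  have "(\<integral>\<^sup>+x. ennreal (h x) \<partial>M) \<noteq> \<infinity>" "(\<integral>\<^sup>+x. ennreal (- h x) \<partial>M) \<noteq> \<infinity>"
    using assms by (auto simp: real_integrable_def)
  then show ?thesis
    unfolding ext_integral_def real_lebesgue_integral_def[OF assms]
    by (cases "\<integral>\<^sup>+x. ennreal (h x) \<partial>M"; cases "\<integral>\<^sup>+x. ennreal (- h x) \<partial>M")
      (simp_all add: enn2ereal_ennreal)
qed

lemma grad_eq: "(g has_derivative (\<lambda>v. D \<bullet> v)) (at x) \<Longrightarrow> grad g x = D"
  unfolding grad_def gderiv_def
proof (rule the_equality)
  assume D: "(g has_derivative (\<lambda>v. D \<bullet> v)) (at x)"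
  then show "(g has_derivative (\<lambda>v. v \<bullet> D)) (at x)"
    by (simp add: inner_commute)
  show "E = D" if "(g has_derivative (\<lambda>v. v \<bullet> E)) (at x)" for E
    using has_derivative_unique[OF that D] vector_eq_rdot[of E D]
    by (simp add: fun_eq_iff inner_commute)
qed

lemma grad_componentwise:
  assumes "(g has_derivative g') (at x)"
  shows "grad g x = (\<Sum>b\<in>Basis. g' b *\<^sub>R b)" "g' = (\<lambda>v. grad g x \<bullet> v)"
proof -
  interpret linear g' by (rule has_derivative_linear[OF assms])
  have "g' v = (\<Sum>b\<in>Basis. g' b *\<^sub>R b) \<bullet> v" for v
  proof -
    have "g' v = g' (\<Sum>b\<in>Basis. (v \<bullet> b) *\<^sub>R b)"
      by (simp add: euclidean_representation)
    also have "\<dots> = (\<Sum>b\<in>Basis. (v \<bullet> b) *\<^sub>R g' b)"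
      by (simp only: sum scale)
    also have "\<dots> = (\<Sum>b\<in>Basis. g' b *\<^sub>R b) \<bullet> v"
      by (simp add: inner_sum_left inner_commute[of v] mult.commute)
    finally show ?thesis .
  qed
  then have *: "g' = (\<lambda>v. (\<Sum>b\<in>Basis. g' b *\<^sub>R b) \<bullet> v)"
    by (rule ext)
  have "(g has_derivative (\<lambda>v. (\<Sum>b\<in>Basis. g' b *\<^sub>R b) \<bullet> v)) (at x)"
    using assms by (subst (asm) *)
  then show 1: "grad g x = (\<Sum>b\<in>Basis. g' b *\<^sub>R b)"
    by (rule grad_eq)
  show "g' = (\<lambda>v. grad g x \<bullet> v)"
    unfolding 1 by (rule *)
qed

lemma C_on_grad:
  assumes "C_on (Suc k) UNIV g"
  shows "C_on k UNIV (grad g)" and "(g has_derivative (\<lambda>v. grad g x \<bullet> v)) (at x)"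
proof -
  note d = C_on_has_derivative[OF assms UNIV_I]
  have "grad g = (\<lambda>x. \<Sum>b\<in>Basis. frechet_derivative g (at x) b *\<^sub>R b)"
    by (rule ext) (rule grad_componentwise(1)[OF d])
  moreover have "C_on k UNIV (\<lambda>x. \<Sum>b\<in>Basis. frechet_derivative g (at x) b *\<^sub>R b)"
    using assms by (intro C_on_sum C_on_scaleR C_on_const) simp_all
  ultimately show "C_on k UNIV (grad g)" by simp
  show "(g has_derivative (\<lambda>v. grad g x \<bullet> v)) (at x)"
    using d[of x] grad_componentwise(2)[OF d, of x] by simp
qed

lemma tendsto_cutoff: "(\<lambda>m. cutoff (real (Suc m)) x) \<longlonglongrightarrow> 1"
proof -
  have "(\<lambda>m. 1 / real (Suc m)) \<longlonglongrightarrow> 0"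
    by (rule lim_1_over_n[THEN LIMSEQ_Suc])
  then have "(\<lambda>m. max 0 (1 - (norm x)\<^sup>2 * (1 / real (Suc m))\<^sup>2)) \<longlonglongrightarrow> max 0 (1 - (norm x)\<^sup>2 * 0\<^sup>2)"
    by (intro tendsto_intros)
  then show ?thesis
    by (simp add: cutoff_def power_divide)
qed

text \<open>Two continuous derivatives of g make its gradient Lipschitz on balls, as the cutoff
  requires. Integrability of g ln g is a conclusion: it comes out of Fatou's lemma together with the
  inequality.\<close>

lemma gauss_lsi:
  fixes g :: "'a::euclidean_space \<Rightarrow> real"
  assumes smooth: "C_on (Suc (Suc 0)) UNIV g" and g: "\<And>x. 0 < g x" "integrable (gauss 1) g"
    and J: "integrable (gauss 1) (\<lambda>x. (norm (grad g x))\<^sup>2 / g x)"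
  shows "integrable (gauss 1) (\<lambda>x. g x * ln (g x))"
    and "(\<integral>x. g x * ln (g x) \<partial>gauss 1) - (\<integral>x. g x \<partial>gauss 1) * ln (\<integral>x. g x \<partial>gauss 1)
      \<le> 1 / 2 * (\<integral>x. (norm (grad g x))\<^sup>2 / g x \<partial>gauss 1)"
proof -
  let ?M = "gauss 1 :: 'a measure" and ?\<Gamma> = "grad g"
  interpret prob_space ?M by (rule prob_space_gauss) simp
  \<comment> \<open>The same q m serves as added constant \<epsilon>, as weight \<delta>, and as 1 /
    R. The error coefficient (1 + 1 / \<delta>) * 16 / R^2 becomes 16 (q^2 + q) and tends to
    0.\<close>
  define q where "q m = 1 / real (Suc m)" for m
  define F where "F m x = (cutoff (real (Suc m)) x)\<^sup>2 * g x + q m" for m x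
  define G where "G m x = (cutoff (real (Suc m)) x)\<^sup>2 *\<^sub>R ?\<Gamma> x
    - (4 * cutoff (real (Suc m)) x * g x / (real (Suc m))\<^sup>2) *\<^sub>R x" for m x
  define Eg EJ where "Eg = (\<integral>x. g x \<partial>?M)" and "EJ = (\<integral>x. (norm (?\<Gamma> x))\<^sup>2 / g x \<partial>?M)"
  define r where "r m = 1 / 2 * ((1 + q m) * EJ + (1 + 1 / q m) * (16 / (real (Suc m))\<^sup>2) * Eg)" for m
  have lin: "(\<integral>x. a * ((norm (?\<Gamma> x))\<^sup>2 / g x) + b * g x \<partial>?M) = a * EJ + b * Eg" for a b
    using J g(2) unfolding Eg_def EJ_def
    by (subst Bochner_Integration.integral_add) (auto simp only: integral_mult_right_zero integrable_mult_right)
  have q: "0 < q m" "q m \<le> 1" for m by (simp_all add: q_def)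
  have q_lim: "q \<longlonglongrightarrow> 0"
    unfolding q_def[abs_def] by (rule lim_1_over_n[THEN LIMSEQ_Suc])
  have tame: "\<exists>B L K. tame (q m) B L K (F m) (G m)" for m
    unfolding F_def[abs_def] G_def[abs_def]
    by (rule tame_cutoff[OF C_on_SucD[OF smooth] g(1) C_on_grad(1)[OF smooth]
          C_on_grad(2)[OF smooth] _ q(1)]) auto
  have F_int: "integrable ?M (F m)" "integrable ?M (\<lambda>x. F m x * ln (F m x))"
    "integrable ?M (\<lambda>x. (norm (G m x))\<^sup>2 / F m x)" "\<And>x. 0 < F m x" "F m \<in> borel_measurable borel"
    and F_lsi: "(\<integral>x. F m x * ln (F m x) \<partial>?M) \<le> (\<integral>x. F m x \<partial>?M) * ln (\<integral>x. F m x \<partial>?M) + r m" for m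
  proof -
    obtain B L K where t: "tame (q m) B L K (F m) (G m)"
      using tame by blast
    interpret t: tame_prob "q m" B L K "F m" "G m" ?M
      using t prob_space_axioms by (simp add: tame_prob_def tame_prob_axioms_def)
    note int = t.integrable_shifts[of 0, simplified]
    show "integrable ?M (F m)" "integrable ?M (\<lambda>x. F m x * ln (F m x))"
      "integrable ?M (\<lambda>x. (norm (G m x))\<^sup>2 / F m x)" "\<And>x. 0 < F m x" "F m \<in> borel_measurable borel"
      by (simp_all add: int t.pos)
    have "(\<integral>x. (norm (G m x))\<^sup>2 / F m x \<partial>?M)
      \<le> (\<integral>x. (1 + q m) * ((norm (?\<Gamma> x))\<^sup>2 / g x) + (1 + 1 / q m) * (16 / (real (Suc m))\<^sup>2) * g x \<partial>?M)"
      unfolding F_def G_def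
      by (intro integral_mono fisher_cutoff_le g q int(4)[unfolded F_def G_def]
          Bochner_Integration.integrable_add integrable_mult_right J) simp
    also have "\<dots> = 2 * r m"
      unfolding lin by (simp add: r_def)
    finally show "(\<integral>x. F m x * ln (F m x) \<partial>?M) \<le> (\<integral>x. F m x \<partial>?M) * ln (\<integral>x. F m x \<partial>?M) + r m"
      using tame_lsi_gauss[OF t] by simp
  qed
  have F_lim: "(\<lambda>m. F m x) \<longlonglongrightarrow> g x" for x
  proof -
    have "(\<lambda>m. F m x) \<longlonglongrightarrow> 1\<^sup>2 * g x + 0"
      unfolding F_def by (intro tendsto_intros tendsto_cutoff q_lim)
    then show ?thesis by simp
  qed
  \<comment> \<open>The means need a true limit, not merely a bound from Fatou's lemma, because they
    enter with a negative sign through \<open>Eg * ln Eg\<close>.\<close>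
  have EF_lim: "(\<lambda>m. \<integral>x. F m x \<partial>?M) \<longlonglongrightarrow> Eg"
    unfolding Eg_def
  proof (rule integral_dominated_convergence[where w = "\<lambda>x. g x + 1"])
    show "AE x in ?M. norm (F m x) \<le> g x + 1" for m
    proof (rule AE_I2)
      fix x
      have "(cutoff (real (Suc m)) x)\<^sup>2 * g x \<le> g x"
        using g(1)[of x] cutoff_bounds[of "real (Suc m)" x]
        by (intro mult_left_le_one_le) (auto simp: power_le_one)
      then show "norm (F m x) \<le> g x + 1"
        using F_int(4)[of m x] q[of m] by (simp add: F_def)
    qed
  qed (use g F_int F_lim in \<open>auto simp: borel_measurable_integrable\<close>)
  have Eg: "0 < Eg"
    unfolding Eg_def using g by (intro expectation_greater) auto
  have r_lim: "r \<longlonglongrightarrow> 1 / 2 * EJ"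
  proof -
    have "(1 + 1 / (1 / n)) * (16 / n\<^sup>2) = 16 * ((1 / n)\<^sup>2 + 1 / n)" if "0 < n" for n :: real
      using that by (simp add: power2_eq_square field_simps)
    then have "(1 + 1 / q m) * (16 / (real (Suc m))\<^sup>2) = 16 * ((q m)\<^sup>2 + q m)" for m
      unfolding q_def by (meson of_nat_0_less_iff zero_less_Suc)
    then have "r = (\<lambda>m. 1 / 2 * ((1 + q m) * EJ + (16 * ((q m)\<^sup>2 + q m)) * Eg))"
      by (simp add: r_def[abs_def])
    moreover have "(\<lambda>m. 1 / 2 * ((1 + q m) * EJ + (16 * ((q m)\<^sup>2 + q m)) * Eg))
        \<longlonglongrightarrow> 1 / 2 * ((1 + 0) * EJ + (16 * (0\<^sup>2 + 0)) * Eg)"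
      by (intro tendsto_intros q_lim)
    ultimately show ?thesis by simp
  qed
  define A where "A = Eg * ln Eg + 1 / 2 * EJ"
  have "0 \<le> EJ"
    unfolding EJ_def using g(1) less_imp_le by (intro integral_nonneg_AE AE_I2) (simp add: less_imp_le)
  then have A: "0 \<le> A + 1"
    using x_ln_x_ge[of Eg] Eg by (simp add: A_def)
  \<comment> \<open>Adding 1 makes the integrand nonnegative, by the tangent of x ln x at 1; on a
    probability space it adds exactly 1 to the integral.\<close>
  have fatou: "(\<integral>\<^sup>+x. ennreal (g x * ln (g x) + 1) \<partial>?M) \<le> ennreal (A + 1)"
  proof -
    have lim: "(\<lambda>m. ennreal (F m x * ln (F m x) + 1)) \<longlonglongrightarrow> ennreal (g x * ln (g x) + 1)" for x
      using g(1)[of x] by (intro tendsto_ennrealI tendsto_intros F_lim) simp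
    have "(\<integral>\<^sup>+x. ennreal (g x * ln (g x) + 1) \<partial>?M)
        = (\<integral>\<^sup>+x. liminf (\<lambda>m. ennreal (F m x * ln (F m x) + 1)) \<partial>?M)"
      using lim_imp_Liminf[OF sequentially_bot lim] by simp
    also have "\<dots> \<le> liminf (\<lambda>m. \<integral>\<^sup>+x. ennreal (F m x * ln (F m x) + 1) \<partial>?M)"
      using F_int(5) by (intro nn_integral_liminf) simp
    also have "\<dots> \<le> liminf (\<lambda>m. ennreal ((\<integral>x. F m x \<partial>?M) * ln (\<integral>x. F m x \<partial>?M) + r m + 1))"
    proof (rule Liminf_mono, rule always_eventually, rule allI)
      fix m
      have "(\<integral>\<^sup>+x. ennreal (F m x * ln (F m x) + 1) \<partial>?M) = ennreal (\<integral>x. F m x * ln (F m x) + 1 \<partial>?M)"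
      proof (rule nn_integral_eq_integral)
        show "integrable ?M (\<lambda>x. F m x * ln (F m x) + 1)"
          using F_int(2)[of m] by simp
        show "AE x in ?M. 0 \<le> F m x * ln (F m x) + 1"
          using x_ln_x_ge[OF less_imp_le[OF F_int(4)]] by (rule AE_I2)
      qed
      also have "\<dots> = ennreal ((\<integral>x. F m x * ln (F m x) \<partial>?M) + 1)"
        using F_int(2)[of m] by (simp add: prob_space[simplified])
      also have "\<dots> \<le> ennreal ((\<integral>x. F m x \<partial>?M) * ln (\<integral>x. F m x \<partial>?M) + r m + 1)"
        using F_lsi[of m] by (intro ennreal_leI) simp
      finally show "(\<integral>\<^sup>+x. ennreal (F m x * ln (F m x) + 1) \<partial>?M)
          \<le> ennreal ((\<integral>x. F m x \<partial>?M) * ln (\<integral>x. F m x \<partial>?M) + r m + 1)" .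
    qed
    also have "\<dots> = ennreal (A + 1)"
      unfolding A_def using Eg
      by (intro lim_imp_Liminf tendsto_ennrealI tendsto_intros EF_lim r_lim) auto
    finally show ?thesis .
  qed
  have meas [measurable]: "g \<in> borel_measurable borel"
    using borel_measurable_integrable[OF g(2)] by simp
  have ge: "0 \<le> g x * ln (g x) + 1" for x
    using x_ln_x_ge[of "g x"] g(1)[of x] by simp
  have int1: "integrable ?M (\<lambda>x. g x * ln (g x) + 1)"
    using fatou ge by (intro integrableI_bounded) (auto simp: less_top[symmetric] top_unique)
  then have "integrable ?M (\<lambda>x. (g x * ln (g x) + 1) - 1)"
    by (rule Bochner_Integration.integrable_diff) simp
  then show int: "integrable ?M (\<lambda>x. g x * ln (g x))"
    by simp
  have "ennreal (\<integral>x. g x * ln (g x) + 1 \<partial>?M) \<le> ennreal (A + 1)"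
    using fatou ge by (simp add: nn_integral_eq_integral[OF int1])
  then have "(\<integral>x. g x * ln (g x) \<partial>?M) + 1 \<le> A + 1"
    using A int by (simp add: prob_space[simplified] ennreal_le_iff)
  then show "(\<integral>x. g x * ln (g x) \<partial>?M) - (\<integral>x. g x \<partial>?M) * ln (\<integral>x. g x \<partial>?M)
      \<le> 1 / 2 * (\<integral>x. (norm (grad g x))\<^sup>2 / g x \<partial>?M)"
    by (simp add: A_def Eg_def EJ_def)
qed

lemma log_sobolev_gauss: "log_sobolev (gauss 1) 1"
  unfolding log_sobolev_def
proof (intro allI impI)
  fix g :: "'a \<Rightarrow> real"
  let ?M = "gauss 1 :: 'a measure"
  assume "smooth_on UNIV g \<and> (\<forall>y. 0 < g y) \<and> integrable ?M g"
  then have smooth: "C_on (Suc (Suc 0)) UNIV g" and g: "\<And>y. 0 < g y" "integrable ?M g"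
    unfolding smooth_on_def by blast+
  let ?J = "\<lambda>y. (norm (grad g y))\<^sup>2 / g y"
  have [measurable]: "g \<in> borel_measurable borel"
    using borel_measurable_integrable[OF g(2)] by simp
  have "continuous_on UNIV (grad g)"
    using C_on_SucD[OF C_on_grad(1)[OF smooth]] by simp
  then have [measurable]: "grad g \<in> borel_measurable borel"
    by (rule borel_measurable_continuous_onI)
  have J: "0 \<le> ?J y" for y
    using g(1)[of y] by simp
  show "Ent ?M g \<le> ereal (1 / (2 * 1)) * enn2ereal (\<integral>\<^sup>+y. ennreal (?J y) \<partial>?M)"
  proof (cases "(\<integral>\<^sup>+y. ennreal (?J y) \<partial>?M) = \<infinity>")
    \<comment> \<open>An infinite right-hand side makes the claim trivial; otherwise the Fisher
      integrand is integrable and the real-valued inequality applies.\<close>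
    case True
    then show ?thesis by simp
  next
    case False
    then have int: "integrable ?M ?J"
      using J by (intro integrableI_nonneg) (auto simp: less_top[symmetric])
    note lsi = gauss_lsi[OF smooth g int]
    show ?thesis
      using lsi(2) J unfolding Ent_def ext_integral_eq_integral[OF lsi(1)]
      by (simp add: nn_integral_eq_integral[OF int] enn2ereal_ennreal)
  qed
qed

lemma std_gaussian_eq_gauss: "(std_gaussian :: (real ^ 'n) measure) = gauss 1"
proof -
  have "(\<Prod>i\<in>UNIV. std_normal_density (x $ i)) = gauss_density 1 x" for x :: "real ^ 'n"
  proof -
    have basis: "(Basis :: (real ^ 'n) set) = (\<lambda>i. axis i 1) ` UNIV"
      by (auto simp: Basis_vec_def)
    have inj: "inj (\<lambda>i. axis i 1 :: real ^ 'n)"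
      by (auto simp: inj_on_def axis_eq_axis)
    show ?thesis
      unfolding gauss_density_def by (subst basis, subst prod.reindex[OF inj]) (simp add: inner_axis)
  qed
  then show ?thesis
    by (simp add: std_gaussian_def gauss_def)
qed

section \<open>Transfer along a diffeomorphism\<close>

text \<open>Smoothness on the manifold is known only through charts. Near each y a chart around the
  preimage is inserted, which factors the composition into two smooth maps between Euclidean open
  sets.\<close>

lemma smooth_on_comp_inverse_diffeomorphism:
  fixes A :: "('p, 'a::euclidean_space) chart set" and \<psi> :: "'p \<Rightarrow> 'b::euclidean_space"
  assumes X: "smooth_manifold X A" and \<psi>: "diffeomorphism X A euclidean (std_atlas UNIV) \<psi>"
    and f: "smooth_fun X A f"
  shows "smooth_on UNIV (f \<circ> inv_into (topspace X) \<psi>)"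
proof (rule smooth_on_local)
  fix y :: 'b
  define \<theta> where "\<theta> = inv_into (topspace X) \<psi>"
  have cont: "continuous_map euclidean X \<theta>"
    and \<theta>: "\<And>V \<eta>. (V, \<eta>) \<in> A \<Longrightarrow> smooth_on (\<theta> -` V) (\<eta> \<circ> \<theta>)"
    using \<psi> by (auto simp: diffeomorphism_def smooth_map_def std_atlas_def \<theta>_def)
  have "\<theta> y \<in> topspace X"
    using continuous_map_image_subset_topspace[OF cont] by auto
  then have "\<theta> y \<in> (\<Union>c\<in>A. fst c)"
    using X unfolding smooth_manifold_def by simp
  then obtain U \<phi> where U: "(U, \<phi>) \<in> A" "\<theta> y \<in> U"
    by auto
  have chart: "is_chart X (U, \<phi>)"
    using X U by (auto simp: smooth_manifold_def)
  have op: "open (\<theta> -` U)"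
    using chart openin_continuous_map_preimage[OF cont, of U] by (simp add: is_chart_def vimage_def)
  have "topspace (subtopology X U) = U"
    using chart openin_subset by (fastforce simp: is_chart_def)
  then have inj: "inj_on \<phi> U"
    using chart homeomorphic_imp_injective_map by (fastforce simp: is_chart_def)
  have f\<phi>: "smooth_on (\<phi> ` U) (f \<circ> inv_into U \<phi>)"
    using f U(1) by (auto simp: smooth_map_def std_atlas_def)
  have "smooth_on (\<theta> -` U) ((f \<circ> inv_into U \<phi>) \<circ> (\<phi> \<circ> \<theta>))"
    by (rule smooth_on_compose[OF op _ _ \<theta>[OF U(1)] f\<phi>]) (use chart in \<open>auto simp: is_chart_def\<close>)
  then have "smooth_on (\<theta> -` U) (f \<circ> \<theta>)"
    by (subst smooth_on_cong_open[OF op, where g = "(f \<circ> inv_into U \<phi>) \<circ> (\<phi> \<circ> \<theta>)"]) (auto simp: inv_into_f_f[OF inj])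
  then show "\<exists>T. open T \<and> y \<in> T \<and> smooth_on T (f \<circ> inv_into (topspace X) \<psi>)"
    using op U(2) unfolding \<theta>_def by blast
qed

lemma measurable_borel_of:
  assumes "sets M = sets (borel_of X)" "continuous_map X euclidean f"
  shows "f \<in> borel_measurable M"
proof (rule borel_measurableI)
  have X: "{U. openin X U} \<subseteq> Pow (topspace X)"
    using openin_subset by auto
  have space: "space M = topspace X"
    using sets_eq_imp_space_eq[OF assms(1)] X by (simp add: borel_of_def)
  fix S :: "'b set" assume "open S"
  then have "openin X {x \<in> topspace X. f x \<in> S}"
    using openin_continuous_map_preimage[OF assms(2)] by simp
  then have "{x \<in> topspace X. f x \<in> S} \<in> sets (borel_of X)"
    using X by (auto simp: borel_of_def)
  moreover have "f -` S \<inter> space M = {x \<in> topspace X. f x \<in> S}"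
    by (auto simp: space)
  ultimately show "f -` S \<inter> space M \<in> sets M"
    using assms(1) by simp
qed

lemma psi_log_sobolev:
  fixes X :: "'p topology" and A :: "('p, 'a::euclidean_space) chart set"
    and \<mu> :: "'p measure" and \<psi> :: "'p \<Rightarrow> 'b::euclidean_space"
  assumes X: "smooth_manifold X A" and \<mu>: "sets \<mu> = sets (borel_of X)"
    and \<psi>: "diffeomorphism X A euclidean (std_atlas UNIV) \<psi>"
    and lsi: "log_sobolev (distr \<mu> borel \<psi>) \<rho>"
    and f: "smooth_fun X A f" "\<forall>x\<in>topspace X. 0 < f x" "integrable \<mu> f"
  shows "Ent \<mu> f \<le> ereal (1 / (2 * \<rho>)) *
    enn2ereal (\<integral>\<^sup>+x. ennreal ((norm (psi_grad X \<psi> f x))\<^sup>2 / f x) \<partial>\<mu>)"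
proof -
  define \<theta> g where "\<theta> = inv_into (topspace X) \<psi>" and "g = f \<circ> \<theta>"
  have smooth: "smooth_on UNIV g"
    unfolding g_def \<theta>_def by (rule smooth_on_comp_inverse_diffeomorphism[OF X \<psi> f(1)])
  have [measurable]: "g \<in> borel_measurable borel"
    by (intro borel_measurable_continuous_onI smooth_on_imp_continuous_on smooth)
  have "C_on (Suc 0) UNIV g"
    using smooth unfolding smooth_on_def by blast
  then have "continuous_on UNIV (grad g)"
    using C_on_grad(1)[of 0 g] by simp
  then have [measurable]: "grad g \<in> borel_measurable borel"
    by (rule borel_measurable_continuous_onI)
  have cont: "continuous_map X euclidean \<psi>" and bij: "bij_betw \<psi> (topspace X) UNIV"
    using \<psi> by (auto simp: diffeomorphism_def smooth_map_def)
  have [measurable]: "\<psi> \<in> borel_measurable \<mu>"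
    by (rule measurable_borel_of[OF \<mu> cont])
  have space: "space \<mu> = topspace X"
    using sets_eq_imp_space_eq[OF \<mu>] openin_subset[of X] by (auto simp: borel_of_def space_measure_of_conv)
  \<comment> \<open>Outside the carrier of X the maps are arbitrary, so f and
    \<open>g \<circ> \<psi>\<close> are identified only on the space of \<mu>; the integrals below
    are rewritten by congruence there.\<close>
  have f_eq: "f x = g (\<psi> x)" if "x \<in> space \<mu>" for x
    using that bij by (simp add: g_def \<theta>_def space bij_betw_def)
  \<comment> \<open>\<open>log_sobolev\<close> asks for positivity at every y. Surjectivity of
    \<psi> puts \<theta> y into the carrier, where f is positive.\<close>
  have g_pos: "0 < g y" for y
    using f(2) bij inv_into_into[of y \<psi> "topspace X"] by (auto simp: g_def \<theta>_def bij_betw_def)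
  have int: "integrable (distr \<mu> borel \<psi>) g"
    using f(3) Bochner_Integration.integrable_cong[OF refl f_eq, of \<mu>] by (simp add: integrable_distr_eq)
  have ext: "ext_integral (distr \<mu> borel \<psi>) (\<lambda>y. g y * ln (g y)) = ext_integral \<mu> (\<lambda>x. f x * ln (f x))"
    unfolding ext_integral_def
    by (simp add: nn_integral_distr f_eq cong: nn_integral_cong)
  have ent: "Ent (distr \<mu> borel \<psi>) g = Ent \<mu> f"
    unfolding Ent_def ext by (simp add: integral_distr f_eq cong: Bochner_Integration.integral_cong)
  have fisher: "(\<integral>\<^sup>+y. ennreal ((norm (grad g y))\<^sup>2 / g y) \<partial>distr \<mu> borel \<psi>)
      = (\<integral>\<^sup>+x. ennreal ((norm (psi_grad X \<psi> f x))\<^sup>2 / f x) \<partial>\<mu>)"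
    by (simp add: nn_integral_distr f_eq psi_grad_def flip: \<theta>_def g_def cong: nn_integral_cong)
  show ?thesis
    using lsi[unfolded log_sobolev_def, rule_format, of g] smooth g_pos int
    unfolding ent fisher by blast
qed

theorem theorem6p3:
  fixes X :: "'p topology"
    and A :: "('p, real ^ 'n) chart set"
    and \<mu> :: "'p measure"
    and \<psi> :: "'p \<Rightarrow> real ^ 'n"
  assumes "smooth_manifold X A"
    and "prob_space \<mu>"
    and "sets \<mu> = sets (borel_of X)"
    and "diffeomorphism X A euclidean (std_atlas UNIV) \<psi>"
  shows "(distr \<mu> borel \<psi> = std_gaussian \<longrightarrow>
      (\<forall>f. smooth_fun X A f \<and> (\<forall>x\<in>topspace X. 0 < f x) \<and> integrable \<mu> f \<longrightarrow>
        Ent \<mu> f \<le> ereal (1 / 2) *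
          enn2ereal (\<integral>\<^sup>+ x. ennreal ((norm (psi_grad X \<psi> f x))\<^sup>2 / f x) \<partial>\<mu>))) \<and>
    (\<forall>\<rho>>0. log_sobolev (distr \<mu> borel \<psi>) \<rho> \<longrightarrow>
      (\<forall>f. smooth_fun X A f \<and> (\<forall>x\<in>topspace X. 0 < f x) \<and> integrable \<mu> f \<longrightarrow>
        Ent \<mu> f \<le> ereal (1 / (2 * \<rho>)) *
          enn2ereal (\<integral>\<^sup>+ x. ennreal ((norm (psi_grad X \<psi> f x))\<^sup>2 / f x) \<partial>\<mu>)))"
proof (intro conjI impI allI; elim conjE)
  note transfer = psi_log_sobolev[OF assms(1,3,4)]
  fix f assume f: "smooth_fun X A f" "\<forall>x\<in>topspace X. 0 < f x" "integrable \<mu> f"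
  {
    assume "distr \<mu> borel \<psi> = std_gaussian"
    then have "log_sobolev (distr \<mu> borel \<psi>) 1"
      by (simp add: std_gaussian_eq_gauss log_sobolev_gauss)
    from transfer[OF this f] show "Ent \<mu> f \<le> ereal (1 / 2) *
        enn2ereal (\<integral>\<^sup>+ x. ennreal ((norm (psi_grad X \<psi> f x))\<^sup>2 / f x) \<partial>\<mu>)"
      by simp
  }
  fix \<rho> :: real assume "log_sobolev (distr \<mu> borel \<psi>) \<rho>"
  from transfer[OF this f] show "Ent \<mu> f \<le> ereal (1 / (2 * \<rho>)) *
      enn2ereal (\<integral>\<^sup>+ x. ennreal ((norm (psi_grad X \<psi> f x))\<^sup>2 / f x) \<partial>\<mu>)" .
qed

end
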